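(* Let $n\geq 2$ and let $U$ be a non-empty open subset of $\mathbb{S}^n$. (i) Let $g$ be a Riemannian metric on $U$ and denote by $F_g$ the positive smooth function on $U$ uniquely defined by $dV_g=F_g^{(n+1)/4}\,dV_{\overline{g}}$. If the intersections of all equators with $U$ are minimal hypersurfaces in $(U,g)$, then the tensor $k_g:=\frac{1}{F_g}g$ is a positive definite Killing symmetric two-tensor of $(U,\overline{g})$. (ii) Let $k$ be a positive definite Killing symmetric two-tensor of $(U,\overline{g})$ and denote by $D_k$ the positive smooth function on $U$ uniquely defined by $dV_k=D_k^{(n-1)/4}\,dV_{\overline{g}}$. Then the tensor $g_k:=\frac{1}{D_k}k$ is a Riemannian metric on $U$ with respect to which the intersections of all equators with $U$ are minimal hypersurfaces in $(U,g_k)$. (iii) The maps $g\mapsto k_g$ (from the set of Riemannian metrics on $U$ with respect to which the intersections of all equators with $U$ are minimal to the set of positive definite Killing symmetric two-tensors of $(U,\overline{g})$) and $k\mapsto g_k$ (in the opposite direction) are the inverse maps of each other.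
   Context: $\mathbb{S}^n\subset\mathbb{R}^{n+1}$ is the unit sphere centred at the origin and $\overline{g}$ its canonical metric of constant sectional curvature one. An equator of $\mathbb{S}^n$ is the intersection of $\mathbb{S}^n$ with a hyperplane of $\mathbb{R}^{n+1}$ through the origin. A hypersurface is minimal if its mean curvature vanishes identically (for $n=2$: it is a geodesic up to parametrization). A Killing symmetric two-tensor of a Riemannian manifold $(M,h)$ is a smooth symmetric two-tensor $k$ on $M$ such that $k(\gamma',\gamma')$ is constant along every geodesic $\gamma$ of $(M,h)$; equivalently $(\nabla^h k)(X,X,X)=0$ for every tangent vector field $X$. For a positive definite symmetric two-tensor $h$ on $U$, $dV_h$ denotes the Riemannian volume element of $h$ regarded as a Riemannian metric. *)

theory Defs
  imports "HOL-Analysis.Analysis"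
begin

section \<open>Smooth functions\<close>

text \<open>The following two definitions are meant for open subsets \<open>S\<close> of the domain.\<close>

primrec Ck_on :: "nat \<Rightarrow> 'a::real_normed_vector set \<Rightarrow> ('a \<Rightarrow> 'b::real_normed_vector) \<Rightarrow> bool" where
  "Ck_on 0 S f \<longleftrightarrow> continuous_on S f"
| "Ck_on (Suc m) S f \<longleftrightarrow>
     (\<forall>x\<in>S. f differentiable (at x)) \<and> (\<forall>v. Ck_on m S (\<lambda>x. frechet_derivative f (at x) v))"

definition smooth_on :: "'a::real_normed_vector set \<Rightarrow> ('a \<Rightarrow> 'b::real_normed_vector) \<Rightarrow> bool" where
  "smooth_on S f \<longleftrightarrow> (\<forall>m. Ck_on m S f)"


section \<open>Calculus on the unit sphere\<close>

text \<open>
  The unit sphere is \<open>sphere 0 1\<close>, its tangent space at \<open>p\<close> is the orthogonal complement of \<open>p\<close>.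
  A function \<open>f\<close> on an open subset \<open>W\<close> of the sphere is studied through its extension
  \<open>x \<mapsto> f (x / norm x)\<close>, constant along rays, to the open cone over \<open>W\<close>. As \<open>x \<mapsto> x / norm x\<close> is a
  smooth retraction of the punctured space onto the sphere, \<open>f\<close> is smooth on the manifold \<open>W\<close> iff
  the extension is smooth on the cone, and for tangent \<open>v\<close> the differential of \<open>f\<close> at \<open>p\<close>
  applied to \<open>v\<close> is that of the extension. Vector fields are regarded as functions with values in
  the ambient space. All definitions below depend only on values at points of the open set under
  consideration, and use tensors on tangent vectors only.
\<close>

definition sphere_open :: "'a::euclidean_space set \<Rightarrow> bool" where
  "sphere_open W \<longleftrightarrow> openin (top_of_set (sphere 0 1)) W"

definition tangent_space :: "'a::euclidean_space \<Rightarrow> 'a set" where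
  "tangent_space p = {v. p \<bullet> v = 0}"

definition tangent_proj :: "'a::euclidean_space \<Rightarrow> 'a \<Rightarrow> 'a" where
  "tangent_proj p v = v - (p \<bullet> v) *\<^sub>R p"

definition sphere_smooth_on :: "'a::euclidean_space set \<Rightarrow> ('a \<Rightarrow> 'b::real_normed_vector) \<Rightarrow> bool" where
  "sphere_smooth_on W f \<longleftrightarrow>
     smooth_on {x. x \<noteq> 0 \<and> x /\<^sub>R norm x \<in> W} (\<lambda>x. f (x /\<^sub>R norm x))"

definition sphere_deriv :: "('a::euclidean_space \<Rightarrow> 'b::real_normed_vector) \<Rightarrow> 'a \<Rightarrow> 'a \<Rightarrow> 'b" where
  "sphere_deriv f p v = frechet_derivative (\<lambda>x. f (x /\<^sub>R norm x)) (at p) v"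

definition vector_field_on :: "'a::euclidean_space set \<Rightarrow> ('a \<Rightarrow> 'a) \<Rightarrow> bool" where
  "vector_field_on W X \<longleftrightarrow> sphere_smooth_on W X \<and> (\<forall>p\<in>W. X p \<in> tangent_space p)"

definition lie_bracket :: "('a::euclidean_space \<Rightarrow> 'a) \<Rightarrow> ('a \<Rightarrow> 'a) \<Rightarrow> 'a \<Rightarrow> 'a" where
  "lie_bracket X Y p = sphere_deriv Y p (X p) - sphere_deriv X p (Y p)"


section \<open>Symmetric two-tensors and the Levi-Civita connection\<close>

type_synonym 'a tensor2 = "'a \<Rightarrow> 'a \<Rightarrow> 'a \<Rightarrow> real"

definition symmetric_tensor_on :: "'a::euclidean_space set \<Rightarrow> 'a tensor2 \<Rightarrow> bool" where
  "symmetric_tensor_on U k \<longleftrightarrow>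
     (\<forall>p\<in>U. \<forall>v\<in>tangent_space p. \<forall>w\<in>tangent_space p.
        k p v w = k p w v \<and>
        (\<forall>u\<in>tangent_space p. k p (u + v) w = k p u w + k p v w) \<and>
        (\<forall>c. k p (c *\<^sub>R v) w = c * k p v w)) \<and>
     (\<forall>X Y. vector_field_on U X \<longrightarrow> vector_field_on U Y \<longrightarrow>
        sphere_smooth_on U (\<lambda>p. k p (X p) (Y p)))"

definition positive_definite_on :: "'a::euclidean_space set \<Rightarrow> 'a tensor2 \<Rightarrow> bool" where
  "positive_definite_on U k \<longleftrightarrow> (\<forall>p\<in>U. \<forall>v\<in>tangent_space p. v \<noteq> 0 \<longrightarrow> k p v v > 0)"

definition riemannian_metric_on :: "'a::euclidean_space set \<Rightarrow> 'a tensor2 \<Rightarrow> bool" where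
  "riemannian_metric_on U g \<longleftrightarrow> symmetric_tensor_on U g \<and> positive_definite_on U g"

definition tensor_eq_on :: "'a::euclidean_space set \<Rightarrow> 'a tensor2 \<Rightarrow> 'a tensor2 \<Rightarrow> bool" where
  "tensor_eq_on U g h \<longleftrightarrow>
     (\<forall>p\<in>U. \<forall>v\<in>tangent_space p. \<forall>w\<in>tangent_space p. g p v w = h p v w)"

definition round_metric :: "'a::euclidean_space tensor2" where
  "round_metric p v w = v \<bullet> w"

definition koszul :: "'a::euclidean_space tensor2 \<Rightarrow> ('a \<Rightarrow> 'a) \<Rightarrow> ('a \<Rightarrow> 'a) \<Rightarrow> ('a \<Rightarrow> 'a) \<Rightarrow> 'a \<Rightarrow> real" where
  "koszul g X Y Z p =
     (sphere_deriv (\<lambda>q. g q (Y q) (Z q)) p (X p)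
      + sphere_deriv (\<lambda>q. g q (X q) (Z q)) p (Y p)
      - sphere_deriv (\<lambda>q. g q (X q) (Y q)) p (Z p)
      + g p (lie_bracket X Y p) (Z p)
      - g p (lie_bracket X Z p) (Y p)
      - g p (lie_bracket Y Z p) (X p)) / 2"

text \<open>The value at \<open>p\<close> of the covariant derivative of \<open>Y\<close> in the direction of \<open>X\<close>, for vector
  fields \<open>X\<close>, \<open>Y\<close> on the open set \<open>W\<close>, with respect to the Levi-Civita connection of \<open>g\<close>.\<close>

definition levi_civita ::
  "'a::euclidean_space set \<Rightarrow> 'a tensor2 \<Rightarrow> ('a \<Rightarrow> 'a) \<Rightarrow> ('a \<Rightarrow> 'a) \<Rightarrow> 'a \<Rightarrow> 'a" where
  "levi_civita W g X Y p =
     (THE w. w \<in> tangent_space p \<and>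
        (\<forall>Z. vector_field_on W Z \<longrightarrow> g p w (Z p) = koszul g X Y Z p))"


section \<open>Geodesics and Killing tensors\<close>

abbreviation velocity :: "(real \<Rightarrow> 'a::real_normed_vector) \<Rightarrow> real \<Rightarrow> 'a" where
  "velocity c t \<equiv> vector_derivative c (at t)"

text \<open>The covariant derivative of a vector field \<open>V\<close> along a curve \<open>c\<close>. For an orthonormal basis
  \<open>b\<close> of the ambient space, with projections \<open>E\<^sub>b q = tangent_proj q b\<close>, one has
  \<open>V t = (\<Sum>b. (V t \<bullet> b) *\<^sub>R E\<^sub>b (c t))\<close>. The product rule thus gives the derivative as
  \<open>\<Sum>b. (V' t \<bullet> b) *\<^sub>R E\<^sub>b (c t)\<close>, which is the projection of \<open>V' t\<close>, plus
  \<open>\<Sum>b. (V t \<bullet> b) *\<^sub>R \<nabla>\<^bsub>c' t\<^esub> E\<^sub>b\<close>, which is the second summand below.\<close>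

definition covariant_deriv_along ::
  "'a::euclidean_space set \<Rightarrow> 'a tensor2 \<Rightarrow> (real \<Rightarrow> 'a) \<Rightarrow> (real \<Rightarrow> 'a) \<Rightarrow> real \<Rightarrow> 'a" where
  "covariant_deriv_along U h c V t =
     tangent_proj (c t) (vector_derivative V (at t))
     + levi_civita U h (\<lambda>q. tangent_proj q (velocity c t)) (\<lambda>q. tangent_proj q (V t)) (c t)"

definition geodesic_on :: "'a::euclidean_space set \<Rightarrow> 'a tensor2 \<Rightarrow> real set \<Rightarrow> (real \<Rightarrow> 'a) \<Rightarrow> bool" where
  "geodesic_on U h I c \<longleftrightarrow>
     open I \<and> is_interval I \<and> smooth_on I c \<and> c ` I \<subseteq> U \<and>
     (\<forall>t\<in>I. covariant_deriv_along U h c (velocity c) t = 0)"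

definition killing_tensor_on :: "'a::euclidean_space set \<Rightarrow> 'a tensor2 \<Rightarrow> 'a tensor2 \<Rightarrow> bool" where
  "killing_tensor_on U h k \<longleftrightarrow>
     symmetric_tensor_on U k \<and>
     (\<forall>I c. geodesic_on U h I c \<longrightarrow>
        (\<lambda>t. k (c t) (velocity c t) (velocity c t)) constant_on I)"


section \<open>Minimal hypersurfaces\<close>

definition hypersurface_of :: "'a::euclidean_space set \<Rightarrow> 'a set \<Rightarrow> bool" where
  "hypersurface_of U \<Sigma> \<longleftrightarrow>
     \<Sigma> \<subseteq> U \<and>
     (\<forall>p\<in>\<Sigma>. \<exists>W (u :: 'a \<Rightarrow> real).
        sphere_open W \<and> p \<in> W \<and> W \<subseteq> U \<and> sphere_smooth_on W u \<and>
        \<Sigma> \<inter> W = {q \<in> W. u q = 0} \<and>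
        (\<forall>q\<in>W. \<exists>v\<in>tangent_space q. sphere_deriv u q v \<noteq> 0))"

definition tangent_to :: "'a::euclidean_space set \<Rightarrow> 'a \<Rightarrow> 'a set" where
  "tangent_to \<Sigma> p =
     {v. \<exists>(c :: real \<Rightarrow> 'a) \<epsilon>. \<epsilon> > 0 \<and> smooth_on {-\<epsilon><..<\<epsilon>} c \<and> c ` {-\<epsilon><..<\<epsilon>} \<subseteq> \<Sigma> \<and>
         c 0 = p \<and> (c has_vector_derivative v) (at 0)}"

definition unit_normal :: "'a::euclidean_space tensor2 \<Rightarrow> 'a set \<Rightarrow> 'a \<Rightarrow> 'a \<Rightarrow> bool" where
  "unit_normal g \<Sigma> p \<nu> \<longleftrightarrow>
     \<nu> \<in> tangent_space p \<and> g p \<nu> \<nu> = 1 \<and> (\<forall>v\<in>tangent_to \<Sigma> p. g p \<nu> v = 0)"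

text \<open>The scalar second fundamental form \<open>g(\<nabla>\<^bsub>X\<^esub> Y, \<nu>)\<close> for any local vector fields \<open>X\<close>, \<open>Y\<close> that
  are tangent to \<open>\<Sigma>\<close> along \<open>\<Sigma>\<close> and extend \<open>v\<close>, \<open>w\<close>; its value does not depend on their choice.\<close>

definition second_fundamental_form ::
  "'a::euclidean_space set \<Rightarrow> 'a tensor2 \<Rightarrow> 'a set \<Rightarrow> 'a \<Rightarrow> 'a \<Rightarrow> 'a \<Rightarrow> 'a \<Rightarrow> real" where
  "second_fundamental_form U g \<Sigma> p \<nu> v w =
     (THE s. \<exists>W X Y. sphere_open W \<and> p \<in> W \<and> W \<subseteq> U \<and>
        vector_field_on W X \<and> vector_field_on W Y \<and>
        (\<forall>q\<in>\<Sigma> \<inter> W. X q \<in> tangent_to \<Sigma> q \<and> Y q \<in> tangent_to \<Sigma> q) \<and>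
        X p = v \<and> Y p = w \<and> s = g p (levi_civita W g X Y p) \<nu>)"

definition orthonormal_basis :: "('a::euclidean_space \<Rightarrow> 'a \<Rightarrow> real) \<Rightarrow> 'a set \<Rightarrow> 'a set \<Rightarrow> bool" where
  "orthonormal_basis b V B \<longleftrightarrow>
     B \<subseteq> V \<and> span B = V \<and> (\<forall>v\<in>B. \<forall>w\<in>B. b v w = (if v = w then 1 else 0))"

text \<open>The trace of the second fundamental form; it does not depend on the orthonormal basis.\<close>

definition mean_curvature :: "'a::euclidean_space set \<Rightarrow> 'a tensor2 \<Rightarrow> 'a set \<Rightarrow> 'a \<Rightarrow> 'a \<Rightarrow> real" where
  "mean_curvature U g \<Sigma> p \<nu> =
     (\<Sum>e\<in>(SOME B. orthonormal_basis (g p) (tangent_to \<Sigma> p) B).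
        second_fundamental_form U g \<Sigma> p \<nu> e e)"

definition minimal_hypersurface :: "'a::euclidean_space set \<Rightarrow> 'a tensor2 \<Rightarrow> 'a set \<Rightarrow> bool" where
  "minimal_hypersurface U g \<Sigma> \<longleftrightarrow>
     hypersurface_of U \<Sigma> \<and>
     (\<forall>p\<in>\<Sigma>. \<forall>\<nu>. unit_normal g \<Sigma> p \<nu> \<longrightarrow> mean_curvature U g \<Sigma> p \<nu> = 0)"

definition equators :: "'a::euclidean_space set set" where
  "equators = {sphere 0 1 \<inter> {x. a \<bullet> x = 0} | a. a \<noteq> 0}"

definition equators_minimal :: "'a::euclidean_space set \<Rightarrow> 'a tensor2 \<Rightarrow> bool" where
  "equators_minimal U g \<longleftrightarrow> (\<forall>E\<in>equators. minimal_hypersurface U g (E \<inter> U))"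


section \<open>Volume elements and the two maps\<close>

text \<open>From here on the ambient space is \<open>(real^'n) \<times> real\<close>, a Euclidean space of dimension \<open>n + 1\<close>
  for \<open>n = CARD('n)\<close>, so that tangent frames of the sphere are indexed by \<open>'n\<close>.
  The volume element is given by its values on \<open>n\<close>-tuples of tangent vectors at \<open>p\<close>.\<close>

type_synonym 'n ambient = "(real^'n) \<times> real"

definition volume_element :: "'n::finite ambient tensor2 \<Rightarrow> 'n ambient \<Rightarrow> ('n \<Rightarrow> 'n ambient) \<Rightarrow> real" where
  "volume_element h p e = sqrt (det (\<chi> i j. h p (e i) (e j)))"

definition volume_ratio_at ::
  "'n::finite ambient tensor2 \<Rightarrow> real \<Rightarrow> 'n ambient \<Rightarrow> real \<Rightarrow> bool" where
  "volume_ratio_at h s p c \<longleftrightarrow>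
     (\<forall>e. range e \<subseteq> tangent_space p \<longrightarrow>
        volume_element h p e = (c powr s) * volume_element round_metric p e)"

definition F_of :: "'n::finite ambient tensor2 \<Rightarrow> 'n ambient \<Rightarrow> real" where
  "F_of g p = (THE c. c > 0 \<and> volume_ratio_at g ((real CARD('n) + 1) / 4) p c)"

definition D_of :: "'n::finite ambient tensor2 \<Rightarrow> 'n ambient \<Rightarrow> real" where
  "D_of k p = (THE c. c > 0 \<and> volume_ratio_at k ((real CARD('n) - 1) / 4) p c)"

definition k_of :: "'n::finite ambient tensor2 \<Rightarrow> 'n ambient tensor2" where
  "k_of g p v w = (1 / F_of g p) * g p v w"

definition g_of :: "'n::finite ambient tensor2 \<Rightarrow> 'n ambient tensor2" where
  "g_of k p v w = (1 / D_of k p) * k p v w"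

end

theory Submission
  imports Defs
begin

text \<open>
  Let \<open>g\<close> be a Riemannian metric on \<open>U\<close>, let \<open>\<nabla>\<close> be the Levi-Civita connection of the round metric, and write
  \<open>G(x; y, z)\<close> for \<open>(\<nabla>\<^sub>x g)(y, z)\<close> (the constant \<open>cov_deriv g\<close>). The Levi-Civita connection of \<open>g\<close> differs from \<open>\<nabla>\<close> by a
  tensor \<open>C\<close> with \<open>2 g(C(x, y), z) = G(x; y, z) + G(y; x, z) - G(z; x, y)\<close> (\<open>levi_civita_eq\<close>).
  Equators are totally geodesic for the round metric, so the second fundamental form of an equator
  with respect to \<open>g\<close> is just \<open>g(C(v, w), \<nu>)\<close>. Let \<open>e\<close> run through a \<open>g\<close>-orthonormal basis of the tangent
  space, and put \<open>\<theta>(x) = 2 \<Sum> G(e; e, x) - \<Sum> G(x; e, e)\<close>, which is twice \<open>g(\<Sum> C(e, e), x)\<close>. Removing from the full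
  trace the summand that belongs to \<open>\<nu>\<close>, one finds that the mean curvature with respect to the unit normal \<open>\<nu>\<close> is half of
  \<open>\<theta>(\<nu>) - G(\<nu>; \<nu>, \<nu>)\<close>. Every unit tangent vector is normal to an equator. Hence all equators are minimal iff
  the cubic form \<open>G(x; x, x)\<close> equals \<open>\<theta>(x) g(x, x)\<close> (\<open>equators_minimal_iff\<close>).

  On the other side, a symmetric tensor \<open>k\<close> is Killing iff its cubic form \<open>(\<nabla>\<^sub>x k)(x, x)\<close> vanishes
  (\<open>killing_tensor_iff\<close>), because along a geodesic this cubic form of the velocity is the derivative of
  \<open>k(c', c')\<close>. For \<open>k = g / F\<close> this reads \<open>G(x; x, x) = \<phi>(x) g(x, x)\<close> with \<open>\<phi> = dF / F\<close>.

  So both conditions say that \<open>G(x; x, x)\<close> is a one-form times \<open>g(x, x)\<close>, and it remains to see that the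
  one-forms are the same. Polarizing and tracing an identity \<open>G(x; x, x) = \<eta>(x) g(x, x)\<close> gives
  \<open>\<Sum> G(x; e, e) + 2 \<Sum> G(e; e, x) = (n + 2) \<eta>(x)\<close> (\<open>cubic_trace_identity\<close>), and differentiating
  \<open>dV\<^sub>g = F\<^bsup>(n+1)/4\<^esup> dV\<close> gives \<open>(n + 1) \<phi>(x) = 2 \<Sum> G(x; e, e)\<close> (\<open>volume_ratio_derivative\<close>). From these two
  linear relations \<open>\<eta> = \<theta>\<close> implies \<open>\<theta> = \<phi>\<close>, and \<open>\<eta> = \<phi>\<close> implies \<open>\<phi> = \<theta>\<close>. This is
  \<open>killing_iff_equators_minimal\<close>. Finally, dividing a tensor by \<open>F\<close> multiplies its volume element by
  \<open>F\<^bsup>-n/2\<^esup>\<close>, which exchanges the exponents \<open>(n+1)/4\<close> and \<open>(n-1)/4\<close> and inverts the volume ratio. Hence the two maps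
  are inverse to each other, and the second half of the statement is the first one read backwards.
\<close>


section \<open>Calculus of \<open>C\<^sup>m\<close> functions\<close>

lemma has_derivative_Ck_on:
  assumes "Ck_on (Suc m) S f" "x \<in> S"
  shows "(f has_derivative frechet_derivative f (at x)) (at x)"
  using assms by (simp add: frechet_derivative_works[symmetric])

lemma Ck_on_Suc_imp: "Ck_on (Suc m) S f \<Longrightarrow> Ck_on m S f"
proof (induction m arbitrary: f)
  case 0
  then show ?case
    by (auto intro!: continuous_at_imp_continuous_on simp: differentiable_imp_continuous_within)
next
  case (Suc m)
  then show ?case by (simp del: Ck_on.simps(1)) 
qed

lemma Ck_on_subset: "Ck_on m S f \<Longrightarrow> T \<subseteq> S \<Longrightarrow> Ck_on m T f"
  by (induction m arbitrary: f) (auto intro: continuous_on_subset)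

text \<open>The definition of \<open>Ck_on\<close> uses full derivatives at the points of the set, so that restriction
  to subsets is harmless and smoothness can be tested near each point.\<close>

lemma Ck_on_local:
  assumes "\<And>x. x \<in> S \<Longrightarrow> \<exists>T. open T \<and> x \<in> T \<and> Ck_on m T f"
  shows "Ck_on m S f"
  using assms
proof (induction m arbitrary: f)
  case 0
  then show ?case
    by (metis Ck_on.simps(1) at_within_open continuous_at_imp_continuous_on
        continuous_on_eq_continuous_within)
next
  case (Suc m)
  then show ?case by (simp del: Ck_on.simps(1)) meson
qed

lemma Ck_on_cong:
  assumes "open S" "\<And>x. x \<in> S \<Longrightarrow> f x = g x" "Ck_on m S f"
  shows "Ck_on m S g"
  using assms(2,3)
proof (induction m arbitrary: f g)
  case 0
  then show ?case using continuous_on_cong by fastforce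
next
  case (Suc m)
  have g: "(g has_derivative frechet_derivative f (at x)) (at x)" if "x \<in> S" for x
    using has_derivative_transform_within_open[OF has_derivative_Ck_on[OF Suc.prems(2) that] assms(1) that]
      Suc.prems(1) by simp
  have "Ck_on m S (\<lambda>x. frechet_derivative g (at x) v)" for v
    by (rule Suc.IH[of "\<lambda>x. frechet_derivative f (at x) v"])
      (use Suc.prems frechet_derivative_at[OF g] in auto)
  then show ?case using g by (auto simp: differentiable_def)
qed

text \<open>The way in which closure properties are proved below: exhibit the derivative by a formula
  that is covered by the induction hypothesis.\<close>

lemma Ck_on_SucI:
  assumes "open S" "\<And>x. x \<in> S \<Longrightarrow> (f has_derivative f' x) (at x)"
    and "\<And>v. Ck_on m S (\<lambda>x. f' x v)"
  shows "Ck_on (Suc m) S f"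
proof -
  have "Ck_on m S (\<lambda>x. frechet_derivative f (at x) v)" for v
    by (rule Ck_on_cong[OF assms(1) _ assms(3)[of v]])
      (use frechet_derivative_at[OF assms(2)] in auto)
  then show ?thesis using assms(2) by (auto simp: differentiable_def)
qed

lemma Ck_on_const: "Ck_on m S (\<lambda>x. c)"
  by (induction m arbitrary: c) (auto simp: frechet_derivative_const)

lemma Ck_on_bounded_linear:
  assumes "open S" "bounded_linear L" "Ck_on m S f"
  shows "Ck_on m S (\<lambda>x. L (f x))"
  using assms(3)
proof (induction m arbitrary: f)
  case 0
  then show ?case using bounded_linear.continuous_on[OF assms(2)] by simp
next
  case (Suc m)
  show ?case
    by (rule Ck_on_SucI[OF assms(1), where f'="\<lambda>x h. L (frechet_derivative f (at x) h)"])
      (use Suc in \<open>auto intro: has_derivative_Ck_on[OF Suc.prems] bounded_linear.has_derivative[OF assms(2)]\<close>)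
qed

lemma Ck_on_ident: "open S \<Longrightarrow> Ck_on m S (\<lambda>x. x)"
  by (cases m) (auto intro!: Ck_on_SucI[where f'="\<lambda>x h. h"] Ck_on_const)

lemma Ck_on_add:
  assumes "open S" "Ck_on m S f" "Ck_on m S g"
  shows "Ck_on m S (\<lambda>x. f x + g x)"
  using assms(2,3)
proof (induction m arbitrary: f g)
  case 0
  then show ?case by (simp add: continuous_on_add)
next
  case (Suc m)
  show ?case
    by (rule Ck_on_SucI[OF assms(1), where f'="\<lambda>x h. frechet_derivative f (at x) h + frechet_derivative g (at x) h"])
      (use Suc in \<open>auto intro: has_derivative_Ck_on[OF Suc.prems(1)] has_derivative_Ck_on[OF Suc.prems(2)]
        has_derivative_add\<close>)
qed

lemma Ck_on_bounded_bilinear: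
  assumes "open S" "bounded_bilinear B" "Ck_on m S f" "Ck_on m S g"
  shows "Ck_on m S (\<lambda>x. B (f x) (g x))"
  using assms(3,4)
proof (induction m arbitrary: f g)
  case 0
  then show ?case by (simp add: bounded_bilinear.continuous_on[OF assms(2)])
next
  case (Suc m)
  show ?case
  proof (rule Ck_on_SucI[OF assms(1)])
    show "((\<lambda>x. B (f x) (g x)) has_derivative
        (\<lambda>h. B (f x) (frechet_derivative g (at x) h) + B (frechet_derivative f (at x) h) (g x))) (at x)"
      if "x \<in> S" for x
      by (rule bounded_bilinear.FDERIV[OF assms(2)]) (use Suc that has_derivative_Ck_on in blast)+
    show "Ck_on m S (\<lambda>x. B (f x) (frechet_derivative g (at x) v) + B (frechet_derivative f (at x) v) (g x))" for v
      by (rule Ck_on_add[OF assms(1)]; rule Suc.IH)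
        (use Suc.prems Ck_on_Suc_imp in auto)
  qed
qed

text \<open>The derivative of \<open>f powr s\<close> contains \<open>f powr (s - 1)\<close>, so the induction varies the exponent.
  Reciprocals, norms and roots of determinants are all obtained as real powers.\<close>

lemma Ck_on_powr:
  fixes f :: "'a::real_normed_vector \<Rightarrow> real"
  assumes "open S" "\<And>x. x \<in> S \<Longrightarrow> f x > 0" "Ck_on m S f"
  shows "Ck_on m S (\<lambda>x. f x powr s)"
  using assms(3)
proof (induction m arbitrary: s)
  case 0
  then show ?case using assms(2) by (auto intro!: continuous_on_powr continuous_on_const) force
next
  case (Suc m)
  show ?case
  proof (rule Ck_on_SucI[OF assms(1)])
    show "((\<lambda>x. f x powr s) has_derivative
        (\<lambda>h. s * (f x powr (s - 1) * frechet_derivative f (at x) h))) (at x)" if "x \<in> S" for x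
    proof -
      have "((\<lambda>x. f x powr s) has_derivative
         (\<lambda>h. (f x powr s) * (0 * ln (f x) + frechet_derivative f (at x) h * s / f x))) (at x)"
        by (rule has_derivative_powr)
          (use has_derivative_Ck_on[OF Suc.prems that] assms(2)[OF that] in auto)
      then show ?thesis
        using assms(2)[OF that] by (simp add: powr_diff field_simps)
    qed
    show "Ck_on m S (\<lambda>x. s * (f x powr (s - 1) * frechet_derivative f (at x) v))" for v
      by (intro Ck_on_bounded_bilinear[OF assms(1) bounded_bilinear_mult] Ck_on_const Suc.IH)
        (use Suc.prems Ck_on_Suc_imp in auto)
  qed
qed

lemma smooth_on_imp_has_derivative:
  "smooth_on S f \<Longrightarrow> x \<in> S \<Longrightarrow> (f has_derivative frechet_derivative f (at x)) (at x)"
  unfolding smooth_on_def using has_derivative_Ck_on by blast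

lemma smooth_on_const: "smooth_on S (\<lambda>x. c)"
  by (simp add: smooth_on_def Ck_on_const)

lemma smooth_on_ident: "open S \<Longrightarrow> smooth_on S (\<lambda>x. x)"
  by (simp add: smooth_on_def Ck_on_ident)

lemma smooth_on_subset: "smooth_on S f \<Longrightarrow> T \<subseteq> S \<Longrightarrow> smooth_on T f"
  unfolding smooth_on_def by (blast intro: Ck_on_subset)

lemma smooth_on_cong:
  "open S \<Longrightarrow> (\<And>x. x \<in> S \<Longrightarrow> f x = g x) \<Longrightarrow> smooth_on S f \<Longrightarrow> smooth_on S g"
  unfolding smooth_on_def by (blast intro: Ck_on_cong)

lemma smooth_on_local:
  "(\<And>x. x \<in> S \<Longrightarrow> \<exists>T. open T \<and> x \<in> T \<and> smooth_on T f) \<Longrightarrow> smooth_on S f"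
  unfolding smooth_on_def by (meson Ck_on_local)

lemma smooth_on_bounded_linear:
  "open S \<Longrightarrow> bounded_linear L \<Longrightarrow> smooth_on S f \<Longrightarrow> smooth_on S (\<lambda>x. L (f x))"
  by (simp add: smooth_on_def Ck_on_bounded_linear)

lemma smooth_on_add:
  "open S \<Longrightarrow> smooth_on S f \<Longrightarrow> smooth_on S g \<Longrightarrow> smooth_on S (\<lambda>x. f x + g x)"
  by (simp add: smooth_on_def Ck_on_add)

lemma smooth_on_bounded_bilinear:
  "open S \<Longrightarrow> bounded_bilinear B \<Longrightarrow> smooth_on S f \<Longrightarrow> smooth_on S g \<Longrightarrow> smooth_on S (\<lambda>x. B (f x) (g x))"
  by (simp add: smooth_on_def Ck_on_bounded_bilinear)

lemmas smooth_on_mult = smooth_on_bounded_bilinear[OF _ bounded_bilinear_mult]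
lemmas smooth_on_scaleR = smooth_on_bounded_bilinear[OF _ bounded_bilinear_scaleR]
lemmas smooth_on_inner = smooth_on_bounded_bilinear[OF _ bounded_bilinear_inner]

lemma smooth_on_diff:
  "open S \<Longrightarrow> smooth_on S f \<Longrightarrow> smooth_on S g \<Longrightarrow> smooth_on S (\<lambda>x. f x - g x)"
  using smooth_on_add[of S f "\<lambda>x. - g x"]
    smooth_on_bounded_linear[OF _ bounded_linear_minus[OF bounded_linear_ident], of S g] by simp

lemma smooth_on_powr:
  fixes f :: "'a::real_normed_vector \<Rightarrow> real"
  shows "open S \<Longrightarrow> (\<And>x. x \<in> S \<Longrightarrow> f x > 0) \<Longrightarrow> smooth_on S f \<Longrightarrow> smooth_on S (\<lambda>x. f x powr s)"
  by (simp add: smooth_on_def Ck_on_powr)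

lemma smooth_on_sum:
  "open S \<Longrightarrow> (\<And>i. i \<in> I \<Longrightarrow> smooth_on S (f i)) \<Longrightarrow> smooth_on S (\<lambda>x. \<Sum>i\<in>I. f i x)"
  by (induction I rule: infinite_finite_induct) (auto intro: smooth_on_const smooth_on_add)

lemma smooth_on_prod:
  fixes f :: "'i \<Rightarrow> 'a::real_normed_vector \<Rightarrow> real"
  shows "open S \<Longrightarrow> (\<And>i. i \<in> I \<Longrightarrow> smooth_on S (f i)) \<Longrightarrow> smooth_on S (\<lambda>x. \<Prod>i\<in>I. f i x)"
  by (induction I rule: infinite_finite_induct) (auto intro: smooth_on_const smooth_on_mult)

lemma smooth_on_det:
  fixes f :: "'n::finite \<Rightarrow> 'n \<Rightarrow> 'a::real_normed_vector \<Rightarrow> real"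
  assumes "open S" "\<And>i j. smooth_on S (f i j)"
  shows "smooth_on S (\<lambda>x. det (\<chi> i j. f i j x))"
  unfolding det_def by (simp, intro smooth_on_sum smooth_on_mult smooth_on_const smooth_on_prod assms)

lemma smooth_on_inverse:
  fixes f :: "'a::real_normed_vector \<Rightarrow> real"
  assumes "open S" "\<And>x. x \<in> S \<Longrightarrow> f x > 0" "smooth_on S f"
  shows "smooth_on S (\<lambda>x. inverse (f x))"
  by (rule smooth_on_cong[OF assms(1) _ smooth_on_powr[OF assms, of "-1"]])
    (use assms(2) in \<open>auto simp: powr_minus less_imp_le\<close>)

text \<open>The derivative has the same shape with \<open>p\<close> and \<open>v\<close> replaced by multiples of \<open>v\<close> and \<open>- p\<close>, so
  the induction closes up when \<open>p\<close> and \<open>v\<close> vary.\<close>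

lemma smooth_on_cos_sin:
  assumes "open S"
  shows "smooth_on S (\<lambda>t. cos (s * t) *\<^sub>R p + sin (s * t) *\<^sub>R v)"
proof -
  have "Ck_on m S (\<lambda>t. cos (s * t) *\<^sub>R p + sin (s * t) *\<^sub>R v)" for m
  proof (induction m arbitrary: p v)
    case 0
    then show ?case by (auto intro!: continuous_intros)
  next
    case (Suc m)
    show ?case
    proof (rule Ck_on_SucI[OF assms])
      show "((\<lambda>t. cos (s * t) *\<^sub>R p + sin (s * t) *\<^sub>R v) has_derivative
         (\<lambda>h. cos (s * t) *\<^sub>R ((h * s) *\<^sub>R v) + sin (s * t) *\<^sub>R (- (h * s) *\<^sub>R p))) (at t)" for t
        by (auto intro!: derivative_eq_intros simp: algebra_simps)
    qed (rule Suc)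
  qed
  then show ?thesis by (simp add: smooth_on_def)
qed


section \<open>Smooth functions and vector fields on the sphere\<close>

abbreviation cone_over :: "'a::euclidean_space set \<Rightarrow> 'a set" where
  "cone_over W \<equiv> {x. x \<noteq> 0 \<and> x /\<^sub>R norm x \<in> W}"

lemma open_cone_over:
  assumes "sphere_open W"
  shows "open (cone_over W)"
proof -
  obtain T where T: "open T" "W = sphere 0 1 \<inter> T"
    using assms unfolding sphere_open_def openin_open by blast
  have "continuous_on (- {0}) (\<lambda>x::'a. x /\<^sub>R norm x)"
    by (auto intro!: continuous_intros)
  then have "open (- {0} \<inter> (\<lambda>x::'a. x /\<^sub>R norm x) -` T)"
    by (rule continuous_open_preimage) (auto simp: T)
  moreover have "cone_over W = - {0} \<inter> (\<lambda>x::'a. x /\<^sub>R norm x) -` T"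
    by (auto simp: T)
  ultimately show ?thesis by simp
qed

lemma sphere_open_norm: "sphere_open W \<Longrightarrow> p \<in> W \<Longrightarrow> norm p = 1"
  unfolding sphere_open_def openin_open by auto

lemma mem_cone_over: "sphere_open W \<Longrightarrow> p \<in> W \<Longrightarrow> p \<in> cone_over W"
  using sphere_open_norm by fastforce

lemma smooth_on_radial: 
  "smooth_on (- {0}) (\<lambda>x::'a::euclidean_space. x /\<^sub>R norm x)"
proof -
  have "smooth_on (- {0}) (\<lambda>x::'a. ((x \<bullet> x) powr (-1/2)) *\<^sub>R x)"
    by (intro smooth_on_scaleR smooth_on_powr smooth_on_inner smooth_on_ident) auto
  then show ?thesis
    by (rule smooth_on_cong[rotated 2])
      (auto simp: powr_minus powr_half_sqrt norm_eq_sqrt_inner)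
qed

lemma has_derivative_radial:
  fixes p :: "'a::euclidean_space"
  assumes "norm p = 1"
  shows "((\<lambda>x. x /\<^sub>R norm x) has_derivative tangent_proj p) (at p)"
proof -
  have "p \<noteq> 0" using assms by auto
  then have "((\<lambda>x. x /\<^sub>R norm x) has_derivative
     (\<lambda>h. inverse (norm p) *\<^sub>R h + (- (inverse (norm p) * (h \<bullet> sgn p) * inverse (norm p))) *\<^sub>R p)) (at p)"
    by (auto intro!: derivative_eq_intros has_derivative_norm)
  then show ?thesis
    using assms by (simp add: tangent_proj_def[abs_def] sgn_div_norm inner_commute algebra_simps)
qed

lemma sphere_deriv_eqI:
  "((\<lambda>x. f (x /\<^sub>R norm x)) has_derivative D) (at p) \<Longrightarrow> sphere_deriv f p = D"
  unfolding sphere_deriv_def[abs_def] using frechet_derivative_at by metis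

lemma sphere_has_derivative:
  assumes "sphere_open W" "p \<in> W" "sphere_smooth_on W f"
  shows "((\<lambda>x. f (x /\<^sub>R norm x)) has_derivative sphere_deriv f p) (at p)"
  using smooth_on_imp_has_derivative[OF assms(3)[unfolded sphere_smooth_on_def] mem_cone_over[OF assms(1,2)]]
  by (simp add: sphere_deriv_def[abs_def])

lemma linear_sphere_deriv:
  "sphere_open W \<Longrightarrow> p \<in> W \<Longrightarrow> sphere_smooth_on W f \<Longrightarrow> linear (sphere_deriv f p)"
  using sphere_has_derivative has_derivative_linear by blast

lemma sphere_has_derivative_ambient:
  assumes "norm p = 1" "(f has_derivative D) (at p)"
  shows "((\<lambda>x. f (x /\<^sub>R norm x)) has_derivative (\<lambda>v. D (tangent_proj p v))) (at p)"
proof -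
  have "p /\<^sub>R norm p = p" using assms by simp
  then show ?thesis
    using has_derivative_compose[OF has_derivative_radial[OF assms(1)], of f D] assms by simp
qed

lemma sphere_deriv_along_curve:
  assumes "((\<lambda>x. f (x /\<^sub>R norm x)) has_derivative D) (at (c t))"
    and "(c has_vector_derivative v) (at t)"
    and "open I" "t \<in> I" "\<And>s. s \<in> I \<Longrightarrow> norm (c s) = 1"
  shows "((\<lambda>s. f (c s)) has_vector_derivative D v) (at t)"
proof -
  interpret D: bounded_linear D using assms(1) has_derivative_bounded_linear by blast
  have "((\<lambda>s. f (c s /\<^sub>R norm (c s))) has_derivative (\<lambda>h. D (h *\<^sub>R v))) (at t)"
    using has_derivative_compose[OF assms(2)[unfolded has_vector_derivative_def] assms(1)] .
  then have "((\<lambda>s. f (c s)) has_derivative (\<lambda>h. D (h *\<^sub>R v))) (at t)"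
    by (rule has_derivative_transform_within_open[OF _ assms(3,4)]) (simp add: assms(5))
  then show ?thesis by (simp add: has_vector_derivative_def D.scaleR)
qed

lemma sphere_smooth_on_subset:
  "sphere_smooth_on W f \<Longrightarrow> W' \<subseteq> W \<Longrightarrow> sphere_smooth_on W' f"
  unfolding sphere_smooth_on_def by (erule smooth_on_subset) auto

lemma sphere_smooth_on_cong:
  assumes "sphere_open W" "\<And>p. p \<in> W \<Longrightarrow> f p = g p" "sphere_smooth_on W f"
  shows "sphere_smooth_on W g"
  using assms(3) unfolding sphere_smooth_on_def
  by (rule smooth_on_cong[OF open_cone_over[OF assms(1)], rotated]) (auto intro: assms(2))

lemma sphere_smooth_on_ambient:
  assumes "sphere_open W"
  shows sphere_smooth_on_const: "sphere_smooth_on W (\<lambda>x. c)"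
    and sphere_smooth_on_ident: "sphere_smooth_on W (\<lambda>x. x)"
  using smooth_on_subset[OF smooth_on_radial, of "cone_over W"]
  by (auto simp: sphere_smooth_on_def smooth_on_const)

lemma sphere_smooth_on_bounded_bilinear:
  "sphere_open W \<Longrightarrow> bounded_bilinear B \<Longrightarrow> sphere_smooth_on W f \<Longrightarrow> sphere_smooth_on W g \<Longrightarrow>
    sphere_smooth_on W (\<lambda>x. B (f x) (g x))"
  unfolding sphere_smooth_on_def by (rule smooth_on_bounded_bilinear[OF open_cone_over])

lemmas sphere_smooth_on_mult = sphere_smooth_on_bounded_bilinear[OF _ bounded_bilinear_mult]
lemmas sphere_smooth_on_scaleR = sphere_smooth_on_bounded_bilinear[OF _ bounded_bilinear_scaleR]
lemmas sphere_smooth_on_inner = sphere_smooth_on_bounded_bilinear[OF _ bounded_bilinear_inner]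

lemma sphere_smooth_on_diff:
  "sphere_open W \<Longrightarrow> sphere_smooth_on W f \<Longrightarrow> sphere_smooth_on W g \<Longrightarrow>
    sphere_smooth_on W (\<lambda>x. f x - g x)"
  unfolding sphere_smooth_on_def by (rule smooth_on_diff[OF open_cone_over])

lemma sphere_smooth_on_inverse:
  fixes f :: "'a::euclidean_space \<Rightarrow> real"
  shows "sphere_open W \<Longrightarrow> (\<And>p. p \<in> W \<Longrightarrow> f p > 0) \<Longrightarrow> sphere_smooth_on W f \<Longrightarrow>
    sphere_smooth_on W (\<lambda>x. inverse (f x))"
  unfolding sphere_smooth_on_def by (rule smooth_on_inverse[OF open_cone_over]) auto

lemma sphere_smooth_on_powr:
  fixes f :: "'a::euclidean_space \<Rightarrow> real"
  shows "sphere_open W \<Longrightarrow> (\<And>p. p \<in> W \<Longrightarrow> f p > 0) \<Longrightarrow> sphere_smooth_on W f \<Longrightarrow>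
    sphere_smooth_on W (\<lambda>x. f x powr s)"
  unfolding sphere_smooth_on_def by (rule smooth_on_powr[OF open_cone_over]) auto

lemma sphere_smooth_on_det:
  fixes f :: "'n::finite \<Rightarrow> 'n \<Rightarrow> 'a::euclidean_space \<Rightarrow> real"
  shows "sphere_open W \<Longrightarrow> (\<And>i j. sphere_smooth_on W (f i j)) \<Longrightarrow>
    sphere_smooth_on W (\<lambda>x. det (\<chi> i j. f i j x))"
  unfolding sphere_smooth_on_def by (rule smooth_on_det[OF open_cone_over])

lemma sphere_smooth_on_local:
  assumes "\<And>p. p \<in> W \<Longrightarrow> \<exists>W'. sphere_open W' \<and> p \<in> W' \<and> sphere_smooth_on W' f"
  shows "sphere_smooth_on W f"
  unfolding sphere_smooth_on_def
proof (rule smooth_on_local)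
  fix x assume "x \<in> cone_over W"
  then obtain W' where "sphere_open W'" "x /\<^sub>R norm x \<in> W'" "sphere_smooth_on W' f" "x \<noteq> 0"
    using assms by blast
  then show "\<exists>T. open T \<and> x \<in> T \<and> smooth_on T (\<lambda>x. f (x /\<^sub>R norm x))"
    using open_cone_over[of W'] unfolding sphere_smooth_on_def by blast
qed

lemma sphere_open_Int_open: "sphere_open W \<Longrightarrow> open T \<Longrightarrow> sphere_open (W \<inter> T)"
  unfolding sphere_open_def openin_open by blast

lemma sphere_open_continuous_nonzero:
  fixes f :: "'a::euclidean_space \<Rightarrow> real"
  assumes "sphere_open W" "continuous_on UNIV f"
  shows "sphere_open {q \<in> W. f q \<noteq> 0}"
proof -
  have "open (f -` (- {0}))" using assms(2) by (intro open_vimage) auto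
  from sphere_open_Int_open[OF assms(1) this] show ?thesis
    by (simp add: Int_def vimage_def)
qed

lemma subspace_tangent_space: "subspace (tangent_space p)"
  unfolding tangent_space_def by (rule subspace_hyperplane)

lemma tangent_proj_tangent [simp]: "v \<in> tangent_space p \<Longrightarrow> tangent_proj p v = v"
  by (simp add: tangent_space_def tangent_proj_def)

lemma tangent_proj_in [simp]: "norm p = 1 \<Longrightarrow> tangent_proj p v \<in> tangent_space p"
  by (simp add: tangent_space_def tangent_proj_def inner_diff_right norm_eq_1)

lemma linear_tangent_proj: "linear (tangent_proj p)"
  by (auto intro!: linearI simp: tangent_proj_def algebra_simps inner_add_right)

lemma dim_tangent_space:
  fixes p :: "'n::finite ambient"
  assumes "norm p = 1"
  shows "dim (tangent_space p) = CARD('n)"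
proof -
  have "p \<noteq> 0" using assms by auto
  then show ?thesis using dim_hyperplane[of p] by (simp add: tangent_space_def)
qed

lemma vector_field_on_tangent_proj:
  "sphere_open W \<Longrightarrow> vector_field_on W (\<lambda>q. tangent_proj q v)"
  unfolding vector_field_on_def
proof (intro conjI ballI)
  assume W: "sphere_open W"
  show "sphere_smooth_on W (\<lambda>q. tangent_proj q v)" unfolding tangent_proj_def
    by (intro sphere_smooth_on_diff sphere_smooth_on_scaleR sphere_smooth_on_inner
        sphere_smooth_on_const sphere_smooth_on_ident W)
  show "tangent_proj q v \<in> tangent_space q" if "q \<in> W" for q
    using sphere_open_norm[OF W that] by simp
qed

lemma sphere_deriv_tangent_proj:
  fixes p :: "'a::euclidean_space"
  assumes "norm p = 1" "x \<in> tangent_space p"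
  shows "sphere_deriv (\<lambda>q. tangent_proj q y) p x = - ((p \<bullet> y) *\<^sub>R x + (x \<bullet> y) *\<^sub>R p)"
proof -
  have "((\<lambda>q. tangent_proj q y) has_derivative (\<lambda>h. - ((p \<bullet> y) *\<^sub>R h + (h \<bullet> y) *\<^sub>R p))) (at p)"
    unfolding tangent_proj_def by (auto intro!: derivative_eq_intros)
  from sphere_deriv_eqI[OF sphere_has_derivative_ambient[OF assms(1) this]] assms(2)
  show ?thesis by simp
qed

text \<open>Differentiate \<open>q \<bullet> Y q = 0\<close>. The normal part of the derivative is thus symmetric in the
  direction and in the field, so that it cancels in Lie brackets.\<close>

lemma sphere_deriv_vector_field_normal:
  fixes Y :: "'a::euclidean_space \<Rightarrow> 'a"
  assumes W: "sphere_open W" "p \<in> W" and Y: "vector_field_on W Y" and x: "x \<in> tangent_space p"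
  shows "p \<bullet> sphere_deriv Y p x = - (x \<bullet> Y p)"
proof -
  have p: "norm p = 1" using sphere_open_norm W by blast
  have smooth: "sphere_smooth_on W Y" using Y by (simp add: vector_field_on_def)
  have "((\<lambda>x. (x /\<^sub>R norm x) \<bullet> Y (x /\<^sub>R norm x)) has_derivative
      (\<lambda>h. (p /\<^sub>R norm p) \<bullet> sphere_deriv Y p h + tangent_proj p h \<bullet> Y (p /\<^sub>R norm p))) (at p)"
    by (rule has_derivative_inner[OF has_derivative_radial[OF p] sphere_has_derivative[OF W smooth]])
  moreover have "((\<lambda>x. (x /\<^sub>R norm x) \<bullet> Y (x /\<^sub>R norm x)) has_derivative (\<lambda>h. 0)) (at p)"
    by (rule has_derivative_transform_within_open[OF has_derivative_const open_cone_over[OF W(1)]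
          mem_cone_over[OF W]])
      (use Y in \<open>auto simp: vector_field_on_def tangent_space_def\<close>)
  ultimately have "(\<lambda>h. (p /\<^sub>R norm p) \<bullet> sphere_deriv Y p h + tangent_proj p h \<bullet> Y (p /\<^sub>R norm p)) = (\<lambda>h. 0)"
    by (rule has_derivative_unique)
  from fun_cong[OF this, of x] show ?thesis using p x by simp
qed

lemma lie_bracket_tangent:
  assumes W: "sphere_open W" "p \<in> W" and XY: "vector_field_on W X" "vector_field_on W Y"
  shows "lie_bracket X Y p = tangent_proj p (sphere_deriv Y p (X p)) - tangent_proj p (sphere_deriv X p (Y p))"
proof -
  have "X p \<in> tangent_space p" "Y p \<in> tangent_space p" using XY W by (auto simp: vector_field_on_def)
  then show ?thesis
    using sphere_deriv_vector_field_normal[OF W] XY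
    by (simp add: lie_bracket_def tangent_proj_def inner_commute)
qed


section \<open>Positive definite forms on a subspace\<close>

text \<open>Tensors are only meaningful on tangent vectors, so linear algebra is done for forms that are
  controlled on a subspace \<open>V\<close> alone.\<close>

locale pos_def_form =
  fixes V :: "'a::euclidean_space set" and b :: "'a \<Rightarrow> 'a \<Rightarrow> real"
  assumes subspace: "subspace V"
    and sym: "v \<in> V \<Longrightarrow> w \<in> V \<Longrightarrow> b v w = b w v"
    and add_left: "u \<in> V \<Longrightarrow> v \<in> V \<Longrightarrow> w \<in> V \<Longrightarrow> b (u + v) w = b u w + b v w"
    and scale_left: "v \<in> V \<Longrightarrow> w \<in> V \<Longrightarrow> b (c *\<^sub>R v) w = c * b v w"
    and pos: "v \<in> V \<Longrightarrow> v \<noteq> 0 \<Longrightarrow> b v v > 0"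
begin

lemma zero_left: "w \<in> V \<Longrightarrow> b 0 w = 0"
  using scale_left[of w w 0] by simp

lemma sum_left:
  "(\<And>i. i \<in> I \<Longrightarrow> f i \<in> V) \<Longrightarrow> w \<in> V \<Longrightarrow> b (\<Sum>i\<in>I. f i) w = (\<Sum>i\<in>I. b (f i) w)"
proof (induction I rule: infinite_finite_induct)
  case (insert i I)
  then show ?case using subspace_sum[OF subspace, of I f] by (simp add: add_left)
qed (simp_all add: zero_left)

lemma lincomb_left:
  assumes "\<And>i. i \<in> I \<Longrightarrow> f i \<in> V" "w \<in> V"
  shows "b (\<Sum>i\<in>I. u i *\<^sub>R f i) w = (\<Sum>i\<in>I. u i * b (f i) w)"
  using assms by (simp add: sum_left subspace_scale[OF subspace] scale_left)

lemma diff_left: "u \<in> V \<Longrightarrow> v \<in> V \<Longrightarrow> w \<in> V \<Longrightarrow> b (u - v) w = b u w - b v w"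
  using add_left[of u "(-1) *\<^sub>R v" w] scale_left[of v w "-1"] subspace_scale[OF subspace, of v "-1"]
  by simp

lemma nondegenerate:
  assumes "u \<in> V" "v \<in> V" "\<And>w. w \<in> V \<Longrightarrow> b u w = b v w"
  shows "u = v"
proof (rule ccontr)
  assume "u \<noteq> v"
  then have "b (u - v) (u - v) > 0" using assms subspace by (intro pos subspace_diff) auto
  moreover have "b (u - v) (u - v) = 0"
    using assms diff_left[of u v "u - v"] subspace_diff[OF subspace] by simp
  ultimately show False by simp
qed

definition orthonormal :: "'a set \<Rightarrow> bool" where
  "orthonormal B \<longleftrightarrow> B \<subseteq> V \<and> (\<forall>v\<in>B. \<forall>w\<in>B. b v w = (if v = w then 1 else 0))"

lemma orthonormal_basis_iff: "orthonormal_basis b V B \<longleftrightarrow> orthonormal B \<and> span B = V"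
  by (auto simp: orthonormal_basis_def orthonormal_def)

lemma orthonormal_coeff:
  assumes "orthonormal B" "S \<subseteq> B" "finite S" "e \<in> S"
  shows "b (\<Sum>v\<in>S. u v *\<^sub>R v) e = u e"
proof -
  have "b (\<Sum>v\<in>S. u v *\<^sub>R v) e = (\<Sum>v\<in>S. u v * b v e)"
    by (rule lincomb_left) (use assms in \<open>auto simp: orthonormal_def\<close>)
  also have "\<dots> = (\<Sum>v\<in>S. if v = e then u e else 0)"
    using assms by (intro sum.cong) (auto simp: orthonormal_def subset_iff)
  finally show ?thesis using assms by simp
qed

lemma orthonormal_independent:
  assumes "orthonormal B" shows "independent B"
  unfolding independent_explicit_finite_subsets
proof (intro allI impI ballI)
  fix S u e
  assume S: "S \<subseteq> B" "finite S" "(\<Sum>v\<in>S. u v *\<^sub>R v) = 0" "e \<in> S"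
  then have "u e = b 0 e" using orthonormal_coeff[OF assms S(1,2,4), of u] by simp
  also have "\<dots> = 0" using S assms by (intro zero_left) (auto simp: orthonormal_def)
  finally show "u e = 0" .
qed

lemma orthonormal_finite: "orthonormal B \<Longrightarrow> finite B"
  using orthonormal_independent independent_bound by blast

lemma expansion:
  assumes "orthonormal_basis b V B" "v \<in> V"
  shows "v = (\<Sum>e\<in>B. b v e *\<^sub>R e)"
proof -
  have B: "orthonormal B" "finite B" using assms orthonormal_basis_iff orthonormal_finite by auto
  have "v \<in> span B" using assms by (simp add: orthonormal_basis_iff)
  then obtain u where u: "v = (\<Sum>e\<in>B. u e *\<^sub>R e)" using span_finite[OF B(2)] by auto
  then have "b v e = u e" if "e \<in> B" for e
    using orthonormal_coeff[OF B(1) _ B(2) that, of u] by simp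
  then show ?thesis using u by simp
qed

text \<open>An orthonormal set of maximal cardinality spans: otherwise a vector outside the span, minus its
  projection and normalised, would extend the set.\<close>

lemma orthonormal_basis_exists: "\<exists>B. orthonormal_basis b V B"
proof -
  let ?P = "\<lambda>k. \<exists>B. orthonormal B \<and> card B = k"
  have "?P 0" by (intro exI[of _ "{}"]) (simp add: orthonormal_def)
  moreover have "\<forall>k. ?P k \<longrightarrow> k \<le> DIM('a)"
    using orthonormal_independent independent_bound by blast
  ultimately obtain k where k: "?P k" and max: "\<And>l. ?P l \<Longrightarrow> l \<le> k"
    using Nat.ex_has_greatest_nat[of ?P 0 "DIM('a)"] by blast
  then obtain B where B: "orthonormal B" "card B = k" by blast
  have fin: "finite B" by (rule orthonormal_finite[OF B(1)])
  have BV: "B \<subseteq> V" using B by (simp add: orthonormal_def)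
  have "v \<in> span B" if v: "v \<in> V" for v
  proof (rule ccontr)
    assume nv: "v \<notin> span B"
    define w where "w = v - (\<Sum>e\<in>B. b v e *\<^sub>R e)"
    have sum: "(\<Sum>e\<in>B. b v e *\<^sub>R e) \<in> V"
      using BV by (intro subspace_sum[OF subspace] subspace_scale[OF subspace]) auto
    have "(\<Sum>e\<in>B. b v e *\<^sub>R e) \<in> span B" by (intro span_sum span_scale span_base)
    with nv have w0: "w \<noteq> 0" by (auto simp: w_def)
    have wV: "w \<in> V" using v sum by (simp add: w_def subspace_diff[OF subspace])
    have we: "b w e = 0" if "e \<in> B" for e
      using orthonormal_coeff[OF B(1) _ fin that, of "b v"] diff_left[OF v sum, of e] that BV
      by (auto simp: w_def)
    define c where "c = 1 / sqrt (b w w)"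
    have c: "c * (c * b w w) = 1" using pos[OF wV w0] by (simp add: c_def)
    have uV: "c *\<^sub>R w \<in> V" using wV by (rule subspace_scale[OF subspace])
    have "b (c *\<^sub>R w) (c *\<^sub>R w) = 1"
      using c scale_left[OF wV uV, of c] sym[OF wV uV] scale_left[OF wV wV, of c] by simp
    moreover have "b (c *\<^sub>R w) e = 0" "b e (c *\<^sub>R w) = 0" if "e \<in> B" for e
      using that BV scale_left[OF wV, of e c] we[OF that] sym[OF uV, of e] by auto
    ultimately have "orthonormal (insert (c *\<^sub>R w) B)"
      using B(1) uV unfolding orthonormal_def by auto
    moreover have "c *\<^sub>R w \<notin> B"
    proof
      assume "c *\<^sub>R w \<in> B"
      then have "b (c *\<^sub>R w) (c *\<^sub>R w) = 0"
        using \<open>\<And>e. e \<in> B \<Longrightarrow> b (c *\<^sub>R w) e = 0\<close> by blast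
      then show False using \<open>b (c *\<^sub>R w) (c *\<^sub>R w) = 1\<close> by simp
    qed
    ultimately have "?P (Suc k)" using B fin by (intro exI[of _ "insert (c *\<^sub>R w) B"]) auto
    then show False using max by fastforce
  qed
  moreover have "span B \<subseteq> V" using BV subspace by (simp add: span_minimal)
  ultimately show ?thesis using B by (auto simp: orthonormal_basis_iff)
qed

lemma sum_orthonormal_coeff:
  assumes "orthonormal_basis b V B" "v \<in> V" "linear (\<phi> :: 'a \<Rightarrow> real)"
  shows "(\<Sum>e\<in>B. b v e * \<phi> e) = \<phi> v"
proof -
  have "\<phi> v = \<phi> (\<Sum>e\<in>B. b v e *\<^sub>R e)" using expansion[OF assms(1,2)] by simp
  also have "\<dots> = (\<Sum>e\<in>B. b v e * \<phi> e)"
    using assms(3) by (simp add: linear_sum linear_cmul)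
  finally show ?thesis by simp
qed

text \<open>The representing vector is \<open>\<Sum> \<phi>(e) e\<close> for an orthonormal basis.\<close>

lemma riesz:
  assumes "linear (\<phi> :: 'a \<Rightarrow> real)"
  obtains w where "w \<in> V" "\<And>z. z \<in> V \<Longrightarrow> b w z = \<phi> z"
proof -
  obtain B where B: "orthonormal_basis b V B" using orthonormal_basis_exists by blast
  have BV: "B \<subseteq> V" using B by (simp add: orthonormal_basis_def)
  let ?w = "\<Sum>e\<in>B. \<phi> e *\<^sub>R e"
  have "?w \<in> V" using BV by (intro subspace_sum[OF subspace] subspace_scale[OF subspace]) auto
  moreover have "b ?w z = \<phi> z" if z: "z \<in> V" for z
  proof -
    have "b ?w z = (\<Sum>e\<in>B. \<phi> e * b e z)" using BV z by (intro lincomb_left) auto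
    also have "\<dots> = (\<Sum>e\<in>B. b z e * \<phi> e)"
      using BV z sym by (intro sum.cong) auto
    finally show ?thesis using sum_orthonormal_coeff[OF B z assms] by simp
  qed
  ultimately show thesis using that by blast
qed

text \<open>Expand one basis in terms of the other, in one argument of \<open>\<beta>\<close> first and then, after exchanging
  the sums, back in the other argument.\<close>

lemma trace_basis_independent:
  assumes "bilinear (\<beta> :: 'a \<Rightarrow> 'a \<Rightarrow> real)" "orthonormal_basis b V B" "orthonormal_basis b V C"
  shows "(\<Sum>e\<in>B. \<beta> e e) = (\<Sum>e\<in>C. \<beta> e e)"
proof -
  have BV: "B \<subseteq> V" "C \<subseteq> V" using assms by (auto simp: orthonormal_basis_def)
  have lin: "linear (\<beta> x)" "linear (\<lambda>x. \<beta> x y)" for x y using assms(1) by (auto simp: bilinear_def)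
  have "(\<Sum>e\<in>B. \<beta> e e) = (\<Sum>e\<in>B. \<Sum>f\<in>C. b e f * \<beta> f e)"
    using BV lin by (intro sum.cong sum_orthonormal_coeff[OF assms(3), symmetric]) auto
  also have "\<dots> = (\<Sum>f\<in>C. \<Sum>e\<in>B. b f e * \<beta> f e)"
    using BV sym by (subst sum.swap) (intro sum.cong, auto simp: subset_iff)
  also have "\<dots> = (\<Sum>f\<in>C. \<beta> f f)"
    using BV lin by (intro sum.cong sum_orthonormal_coeff[OF assms(2)]) auto
  finally show ?thesis .
qed

lemma orthonormal_basis_insert_normal:
  assumes "\<nu> \<in> V" "b \<nu> \<nu> = 1" "orthonormal_basis b {w \<in> V. b \<nu> w = 0} B"
  shows "\<nu> \<notin> B" "orthonormal_basis b V (insert \<nu> B)"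
proof -
  have BV: "B \<subseteq> V" "\<And>e. e \<in> B \<Longrightarrow> b \<nu> e = 0" using assms by (auto simp: orthonormal_basis_def)
  then have Bn: "\<And>e. e \<in> B \<Longrightarrow> b e \<nu> = 0" using assms sym by (metis subset_iff)
  show "\<nu> \<notin> B" using BV assms by force
  have "v \<in> span (insert \<nu> B)" if v: "v \<in> V" for v
  proof -
    let ?k = "b v \<nu>"
    have u: "v - ?k *\<^sub>R \<nu> \<in> V"
      using v assms(1) by (intro subspace_diff[OF subspace] subspace_scale[OF subspace])
    have "b (v - ?k *\<^sub>R \<nu>) \<nu> = 0"
      using assms v by (simp add: diff_left scale_left subspace_scale[OF subspace])
    then have "v - ?k *\<^sub>R \<nu> \<in> span B"
      using u assms sym by (auto simp: orthonormal_basis_def)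
    then show ?thesis by (auto simp: span_insert)
  qed
  moreover have "span (insert \<nu> B) \<subseteq> V" using BV assms(1) subspace by (simp add: span_minimal)
  ultimately have "span (insert \<nu> B) = V" by blast
  then show "orthonormal_basis b V (insert \<nu> B)"
    using assms BV Bn unfolding orthonormal_basis_def by auto
qed

text \<open>Polarizing the cubic identity yields \<open>G(x; y, y) + 2 G(y; y, x) = \<theta>(x) b(y, y) + 2 \<theta>(y) b(x, y)\<close>;
  summing over \<open>y = e\<close> turns the last term into \<open>2 \<theta>(x)\<close>.\<close>

lemma cubic_trace_identity:
  fixes G :: "'a \<Rightarrow> 'a \<Rightarrow> 'a \<Rightarrow> real"
  assumes lin1: "\<And>y z. linear (\<lambda>x. G x y z)" and lin2: "\<And>x z. linear (\<lambda>y. G x y z)"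
    and symG: "\<And>x y z. G x y z = G x z y" and \<theta>: "linear \<theta>"
    and cubic: "\<And>x. x \<in> V \<Longrightarrow> G x x x = \<theta> x * b x x"
    and B: "orthonormal_basis b V B" and x: "x \<in> V"
  shows "(\<Sum>e\<in>B. G x e e) + 2 * (\<Sum>e\<in>B. G e e x) = (real (card B) + 2) * \<theta> x"
proof -
  have lin3: "linear (\<lambda>z. G x y z)" for x y using lin2[of x y] symG by simp
  note add = linear_add[OF lin1] linear_add[OF lin2] linear_add[OF lin3] linear_add[OF \<theta>]
  note diff = linear_diff[OF lin1] linear_diff[OF lin2] linear_diff[OF lin3] linear_diff[OF \<theta>]
  have polar: "G x y y + 2 * G y y x = \<theta> x * b y y + 2 * (\<theta> y * b x y)" if y: "y \<in> V" for y
  proof -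
    have V: "x + y \<in> V" "y - x \<in> V" using x y subspace by (auto intro: subspace_add subspace_diff)
    have b1: "b (x + y) (x + y) = b x x + 2 * b x y + b y y"
      using x y V sym[of x "x + y"] sym[of y "x + y"] sym[of x y] by (simp add: add_left)
    have b2: "b (y - x) (y - x) = b x x - 2 * b x y + b y y"
      using x y V sym[of x "y - x"] sym[of y "y - x"] sym[of x y] by (simp add: diff_left)
    \<comment> \<open>the difference of the cubic identities at \<open>x + y\<close> and \<open>y - x\<close> is odd in \<open>x\<close>: besides the cube of \<open>x\<close> it contains only the terms that are linear in \<open>x\<close>\<close>
    have "G x x x + G y y y + (G x y y + G y x y + G y y x) + (G y x x + G x y x + G x x y)
        = (\<theta> x + \<theta> y) * (b x x + 2 * b x y + b y y)"
      using cubic[OF V(1)] by (simp add: add b1)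
    moreover have "G y y y - G x x x - (G x y y + G y x y + G y y x) + (G y x x + G x y x + G x x y)
        = (\<theta> y - \<theta> x) * (b x x - 2 * b x y + b y y)"
      using cubic[OF V(2)] by (simp add: diff b2)
    ultimately show ?thesis
      using cubic[OF x] cubic[OF y] symG[of y x y] by (simp add: algebra_simps)
  qed
  have BV: "B \<subseteq> V" using B by (simp add: orthonormal_basis_def)
  have "(\<Sum>e\<in>B. G x e e) + 2 * (\<Sum>e\<in>B. G e e x) = (\<Sum>e\<in>B. G x e e + 2 * G e e x)"
    by (simp add: sum.distrib sum_distrib_left)
  also have "\<dots> = (\<Sum>e\<in>B. \<theta> x + 2 * (b x e * \<theta> e))"
    using BV B by (intro sum.cong) (auto simp: polar orthonormal_basis_def mult.commute)
  also have "\<dots> = real (card B) * \<theta> x + 2 * (\<Sum>e\<in>B. b x e * \<theta> e)"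
    by (simp add: sum.distrib sum_distrib_left)
  also have "\<dots> = real (card B) * \<theta> x + 2 * \<theta> x"
    using sum_orthonormal_coeff[OF B x \<theta>] by simp
  finally show ?thesis by (simp add: algebra_simps)
qed

lemma card_orthonormal_basis: "orthonormal_basis b V B \<Longrightarrow> card B = dim V"
  using orthonormal_independent dim_span_eq_card_independent by (fastforce simp: orthonormal_basis_iff)

lemma orthonormal_frame_exists:
  assumes "dim V = CARD('n::finite)"
  obtains f :: "'n::finite \<Rightarrow> 'a" where "inj f" "orthonormal_basis b V (range f)"
proof -
  obtain B where B: "orthonormal_basis b V B" using orthonormal_basis_exists by blast
  have "finite B" "card B = CARD('n)"
    using B orthonormal_finite card_orthonormal_basis assms by (auto simp: orthonormal_basis_iff)
  then obtain f :: "'n \<Rightarrow> 'a" where "bij_betw f UNIV B"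
    using finite_same_card_bij[of "UNIV :: 'n set" B] by auto
  then show thesis using that B by (auto simp: bij_betw_def)
qed

lemma orthonormal_frame_gram:
  assumes "inj f" "orthonormal_basis b V (range f)"
  shows "(\<chi> i j. b (f i) (f j)) = mat (1::real)"
  using assms by (auto simp: orthonormal_basis_def mat_def vec_eq_iff inj_eq)

end

text \<open>The Gram matrix of \<open>e\<close> is \<open>A ** G ** transpose A\<close>, where \<open>A\<close> holds the coordinates of \<open>e\<close> in the basis \<open>f\<close>.\<close>

lemma gram_det_change_of_frame:
  fixes f e :: "'n::finite \<Rightarrow> 'a::euclidean_space"
  assumes "pos_def_form V b" "pos_def_form V c"
    and "inj f" "orthonormal_basis b V (range f)" "range e \<subseteq> V"
  shows "det (\<chi> i j. c (e i) (e j)) = (det (\<chi> i j. b (e i) (f j)))\<^sup>2 * det (\<chi> i j. c (f i) (f j))"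
proof -
  interpret b: pos_def_form V b by fact
  interpret c: pos_def_form V c by fact
  have fV: "f k \<in> V" for k using assms(4) by (auto simp: orthonormal_basis_def)
  have eV: "e k \<in> V" for k using assms(5) by auto
  have exp: "e i = (\<Sum>k\<in>UNIV. b (e i) (f k) *\<^sub>R f k)" for i
    using b.expansion[OF assms(4) eV[of i]] unfolding sum.reindex[OF assms(3)] o_def .
  let ?A = "\<chi> i j. b (e i) (f j)" and ?G = "\<chi> i j. c (f i) (f j)"
  have "c (e i) (e j) = (\<Sum>l\<in>UNIV. (\<Sum>k\<in>UNIV. b (e i) (f k) * c (f k) (f l)) * b (e j) (f l))" for i j
  proof -
    have "c (e i) (e j) = (\<Sum>k\<in>UNIV. b (e i) (f k) * c (f k) (e j))"
      by (subst (1) exp, rule c.lincomb_left) (use fV eV in auto)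
    also have "\<dots> = (\<Sum>k\<in>UNIV. b (e i) (f k) * (\<Sum>l\<in>UNIV. b (e j) (f l) * c (f k) (f l)))"
    proof (intro sum.cong refl)
      fix k
      have "c (f k) (e j) = c (e j) (f k)" by (rule c.sym[OF fV eV])
      also have "\<dots> = (\<Sum>l\<in>UNIV. b (e j) (f l) * c (f l) (f k))"
        by (subst (1) exp, rule c.lincomb_left) (use fV eV in auto)
      finally show "b (e i) (f k) * c (f k) (e j) =
          b (e i) (f k) * (\<Sum>l\<in>UNIV. b (e j) (f l) * c (f k) (f l))"
        using c.sym[OF fV fV] by simp
    qed
    finally show ?thesis
      by (simp add: sum_distrib_left sum_distrib_right) (subst sum.swap, simp add: mult_ac)
  qed
  then have "(\<chi> i j. c (e i) (e j)) = ?A ** ?G ** transpose ?A"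
    by (simp add: vec_eq_iff matrix_matrix_mult_def transpose_def)
  then show ?thesis by (simp add: det_mul power2_eq_square)
qed

text \<open>The factor is the Gram determinant of \<open>c\<close> in a \<open>b\<close>-orthonormal frame. It is positive because a
  \<open>c\<close>-orthonormal frame has Gram determinant one, which is this factor times a square.\<close>

lemma gram_det_ratio:
  assumes "pos_def_form V b" "pos_def_form V c" "dim V = CARD('n::finite)"
  obtains r where "r > 0"
    "\<And>e :: 'n::finite \<Rightarrow> 'a::euclidean_space. range e \<subseteq> V \<Longrightarrow>
        det (\<chi> i j. c (e i) (e j)) = r * det (\<chi> i j. b (e i) (e j))"
proof -
  interpret b: pos_def_form V b by fact
  interpret c: pos_def_form V c by fact
  obtain f :: "'n \<Rightarrow> 'a" where f: "inj f" "orthonormal_basis b V (range f)"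
    using b.orthonormal_frame_exists assms(3) by metis
  obtain h :: "'n \<Rightarrow> 'a" where h: "inj h" "orthonormal_basis c V (range h)"
    using c.orthonormal_frame_exists assms(3) by metis
  let ?r = "det (\<chi> i j. c (f i) (f j))"
  have hV: "range h \<subseteq> V" using h by (simp add: orthonormal_basis_def)
  have "1 = (det (\<chi> i j. b (h i) (f j)))\<^sup>2 * ?r"
    using gram_det_change_of_frame[OF assms(1,2) f hV] c.orthonormal_frame_gram[OF h] by simp
  then have "?r > 0" by (metis zero_less_mult_pos zero_less_one zero_le_power2 mult_zero_left less_le)
  moreover have "det (\<chi> i j. c (e i) (e j)) = ?r * det (\<chi> i j. b (e i) (e j))"
    if "range e \<subseteq> V" for e :: "'n \<Rightarrow> 'a"
    using gram_det_change_of_frame[OF assms(1,2) f that] gram_det_change_of_frame[OF assms(1,1) f that]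
      b.orthonormal_frame_gram[OF f] by simp
  ultimately show thesis using that by blast
qed


section \<open>Covariant derivatives of tensors and the Levi-Civita connection\<close>

lemma bilinear_expansion:
  fixes \<beta> :: "'a::euclidean_space \<Rightarrow> 'a \<Rightarrow> real"
  assumes "bilinear \<beta>"
  shows "(\<Sum>b\<in>Basis. \<Sum>c\<in>Basis. (y \<bullet> b) * (z \<bullet> c) * \<beta> b c) = \<beta> y z"
proof -
  have lin: "linear (\<beta> x)" "linear (\<lambda>x. \<beta> x w)" for x w using assms by (auto simp: bilinear_def)
  have "\<beta> y z = \<beta> (\<Sum>b\<in>Basis. (y \<bullet> b) *\<^sub>R b) z" by (simp add: euclidean_representation)
  also have "\<dots> = (\<Sum>b\<in>Basis. (y \<bullet> b) * \<beta> b z)"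
    by (simp add: linear_sum[OF lin(2)] linear_cmul[OF lin(2)])
  also have "\<dots> = (\<Sum>b\<in>Basis. (y \<bullet> b) * \<beta> b (\<Sum>c\<in>Basis. (z \<bullet> c) *\<^sub>R c))"
    by (simp add: euclidean_representation)
  also have "\<dots> = (\<Sum>b\<in>Basis. \<Sum>c\<in>Basis. (y \<bullet> b) * (z \<bullet> c) * \<beta> b c)"
    by (simp add: linear_sum[OF lin(1)] linear_cmul[OF lin(1)] sum_distrib_left mult.assoc)
  finally show ?thesis by simp
qed

lemma has_derivative_radial_cong:
  assumes "sphere_open W" "p \<in> W" "\<And>q. q \<in> W \<Longrightarrow> f q = h q"
    and "((\<lambda>x. f (x /\<^sub>R norm x)) has_derivative D) (at p)"
  shows "((\<lambda>x. h (x /\<^sub>R norm x)) has_derivative D) (at p)"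
  using assms(4) open_cone_over[OF assms(1)] mem_cone_over[OF assms(1,2)]
  by (rule has_derivative_transform_within_open) (use assms(3) in auto)

text \<open>For tangent vectors \<open>x\<close>, \<open>y\<close>, \<open>z\<close> this is \<open>(\<nabla>\<^sub>x k)(y, z)\<close> for the round connection \<open>\<nabla>\<close>, as the projected fields
  \<open>q \<mapsto> tangent_proj q y\<close> are parallel at \<open>p\<close>. Because of the projections it makes
  sense, and is linear, for \<open>y\<close> and \<open>z\<close> in the whole ambient space.\<close>

definition cov_deriv :: "'a::euclidean_space tensor2 \<Rightarrow> 'a \<Rightarrow> 'a \<Rightarrow> 'a \<Rightarrow> 'a \<Rightarrow> real" where
  "cov_deriv k p x y z = sphere_deriv (\<lambda>q. k q (tangent_proj q y) (tangent_proj q z)) p x"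

locale sphere_tensor =
  fixes U :: "'a::euclidean_space set" and k :: "'a tensor2"
  assumes open_U: "sphere_open U" and tensor: "symmetric_tensor_on U k"
begin

lemma norm_U: "p \<in> U \<Longrightarrow> norm p = 1"
  using open_U sphere_open_norm by blast

lemma tensor_sym: "p \<in> U \<Longrightarrow> v \<in> tangent_space p \<Longrightarrow> w \<in> tangent_space p \<Longrightarrow> k p v w = k p w v"
  and tensor_add: "p \<in> U \<Longrightarrow> u \<in> tangent_space p \<Longrightarrow> v \<in> tangent_space p \<Longrightarrow> w \<in> tangent_space p \<Longrightarrow>
    k p (u + v) w = k p u w + k p v w"
  and tensor_scale: "p \<in> U \<Longrightarrow> v \<in> tangent_space p \<Longrightarrow> w \<in> tangent_space p \<Longrightarrow>
    k p (c *\<^sub>R v) w = c * k p v w"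
  and tensor_smooth: "vector_field_on U X \<Longrightarrow> vector_field_on U Y \<Longrightarrow>
    sphere_smooth_on U (\<lambda>q. k q (X q) (Y q))"
  using tensor by (auto simp: symmetric_tensor_on_def)

lemma tensor_diff: "p \<in> U \<Longrightarrow> u \<in> tangent_space p \<Longrightarrow> v \<in> tangent_space p \<Longrightarrow> w \<in> tangent_space p \<Longrightarrow>
    k p (u - v) w = k p u w - k p v w"
  using tensor_add[of p u "(-1) *\<^sub>R v" w] tensor_scale[of p v w "-1"]
    subspace_scale[OF subspace_tangent_space, of v p "-1"] by simp

lemma bilinear_tensor:
  assumes p: "p \<in> U"
  shows "bilinear (\<lambda>v w. k p (tangent_proj p v) (tangent_proj p w))"
proof -
  have tp: "tangent_proj p v \<in> tangent_space p" for v using norm_U[OF p] by simp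
  have 1: "linear (\<lambda>v. k p (tangent_proj p v) (tangent_proj p w))" for w
    by (rule linearI)
      (auto simp: linear_add[OF linear_tangent_proj] linear_cmul[OF linear_tangent_proj]
        tensor_add[OF p] tensor_scale[OF p] tp)
  then show ?thesis
    using tensor_sym[OF p tp tp] by (auto simp: bilinear_def)
qed

lemma component_smooth: "sphere_smooth_on U (\<lambda>q. k q (tangent_proj q y) (tangent_proj q z))"
  by (intro tensor_smooth vector_field_on_tangent_proj open_U)

lemma component_derivative:
  assumes "p \<in> U"
  shows "((\<lambda>x. k (x /\<^sub>R norm x) (tangent_proj (x /\<^sub>R norm x) y) (tangent_proj (x /\<^sub>R norm x) z))
    has_derivative (\<lambda>h. cov_deriv k p h y z)) (at p)"
  using sphere_has_derivative[OF open_U assms component_smooth] by (simp add: cov_deriv_def[abs_def])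

lemma cov_deriv_eqI:
  assumes "p \<in> U" "((\<lambda>x. f (x /\<^sub>R norm x)) has_derivative D) (at p)"
    and "\<And>q. q \<in> U \<Longrightarrow> f q = k q (tangent_proj q y) (tangent_proj q z)"
  shows "cov_deriv k p x y z = D x"
  unfolding cov_deriv_def
  using fun_cong[OF sphere_deriv_eqI[OF has_derivative_radial_cong[OF open_U assms(1,3,2)]], of x] .

lemma cov_deriv_sym: "p \<in> U \<Longrightarrow> cov_deriv k p x y z = cov_deriv k p x z y"
  by (rule cov_deriv_eqI[OF _ component_derivative]) (auto simp: tensor_sym norm_U)

lemma linear_cov_deriv1: "p \<in> U \<Longrightarrow> linear (\<lambda>x. cov_deriv k p x y z)"
  using component_derivative has_derivative_linear by blast

lemma linear_cov_deriv2:
  assumes p: "p \<in> U" shows "linear (\<lambda>y. cov_deriv k p x y z)"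
proof (rule linearI)
  have lin: "linear (\<lambda>v. k q (tangent_proj q v) (tangent_proj q z))" if "q \<in> U" for q
    using bilinear_tensor[OF that] by (auto simp: bilinear_def)
  show "cov_deriv k p x (y + y') z = cov_deriv k p x y z + cov_deriv k p x y' z" for y y'
    by (rule cov_deriv_eqI[OF p has_derivative_add[OF component_derivative[OF p] component_derivative[OF p]]])
      (simp add: linear_add[OF lin])
  show "cov_deriv k p x (c *\<^sub>R y) z = c *\<^sub>R cov_deriv k p x y z" for c y
    by (rule cov_deriv_eqI[OF p has_derivative_scaleR_right[OF component_derivative[OF p]]])
      (simp add: linear_cmul[OF lin])
qed

lemma linear_cov_deriv3:
  assumes p: "p \<in> U" shows "linear (\<lambda>z. cov_deriv k p x y z)"
proof -
  have "(\<lambda>z. cov_deriv k p x y z) = (\<lambda>z. cov_deriv k p x z y)"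
    using cov_deriv_sym[OF p] by (intro ext)
  then show ?thesis using linear_cov_deriv2[OF p, of x y] by argo
qed

text \<open>The Leibniz rule for \<open>k(Y, Z)\<close> along a map \<open>\<phi>\<close> into \<open>U\<close>; the projected derivatives of \<open>Y\<close> and \<open>Z\<close> are their round
  covariant derivatives. It is used with the radial projection for \<open>\<phi>\<close>, for
  fields on the sphere, and with curves. The proof expands \<open>Y\<close> and \<open>Z\<close> in an orthonormal basis of the ambient
  space and applies the ordinary product rule to the coordinates.\<close>

lemma has_derivative_tensor:
  assumes \<phi>: "(\<phi> has_derivative \<phi>') (at s)" and Y: "(Y has_derivative Y') (at s)"
    and Z: "(Z has_derivative Z') (at s)" and T: "open T" "s \<in> T"
    and field: "\<And>t. t \<in> T \<Longrightarrow> \<phi> t \<in> U" "\<And>t. t \<in> T \<Longrightarrow> Y t \<in> tangent_space (\<phi> t)"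
      "\<And>t. t \<in> T \<Longrightarrow> Z t \<in> tangent_space (\<phi> t)"
  shows "((\<lambda>t. k (\<phi> t) (Y t) (Z t)) has_derivative
      (\<lambda>h. cov_deriv k (\<phi> s) (\<phi>' h) (Y s) (Z s)
        + k (\<phi> s) (tangent_proj (\<phi> s) (Y' h)) (Z s)
        + k (\<phi> s) (Y s) (tangent_proj (\<phi> s) (Z' h)))) (at s)"
proof -
  let ?p = "\<phi> s"
  let ?K = "\<lambda>q y z. k q (tangent_proj q y) (tangent_proj q z)"
  have p: "?p \<in> U" using field T by blast
  have cov: "((\<lambda>t. ?K (\<phi> t /\<^sub>R norm (\<phi> t)) b c) has_derivative (\<lambda>h. cov_deriv k ?p (\<phi>' h) b c)) (at s)" for b c
    using has_derivative_compose[OF \<phi> component_derivative[OF p]] .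
  have "((\<lambda>t. \<Sum>b\<in>Basis. \<Sum>c\<in>Basis. (Y t \<bullet> b) * (Z t \<bullet> c) * ?K (\<phi> t /\<^sub>R norm (\<phi> t)) b c) has_derivative
      (\<lambda>h. \<Sum>b\<in>Basis. \<Sum>c\<in>Basis. (Y s \<bullet> b) * (Z s \<bullet> c) * cov_deriv k ?p (\<phi>' h) b c
        + ((Y s \<bullet> b) * (Z' h \<bullet> c) + (Y' h \<bullet> b) * (Z s \<bullet> c)) * ?K (?p /\<^sub>R norm ?p) b c)) (at s)"
    by (intro has_derivative_sum has_derivative_mult has_derivative_inner_left Y Z cov)
  then have der: "((\<lambda>t. k (\<phi> t) (Y t) (Z t)) has_derivative
      (\<lambda>h. \<Sum>b\<in>Basis. \<Sum>c\<in>Basis. (Y s \<bullet> b) * (Z s \<bullet> c) * cov_deriv k ?p (\<phi>' h) b c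
        + ((Y s \<bullet> b) * (Z' h \<bullet> c) + (Y' h \<bullet> b) * (Z s \<bullet> c)) * ?K (?p /\<^sub>R norm ?p) b c)) (at s)"
    by (rule has_derivative_transform_within_open[OF _ T])
      (simp add: bilinear_expansion[OF bilinear_tensor] field norm_U)
  have "bilinear (cov_deriv k ?p x)" for x
    using linear_cov_deriv2[OF p] linear_cov_deriv3[OF p] by (auto simp: bilinear_def)
  note exp = bilinear_expansion[OF this] bilinear_expansion[OF bilinear_tensor[OF p]]
  have "(\<lambda>h. \<Sum>b\<in>Basis. \<Sum>c\<in>Basis. (Y s \<bullet> b) * (Z s \<bullet> c) * cov_deriv k ?p (\<phi>' h) b c
        + ((Y s \<bullet> b) * (Z' h \<bullet> c) + (Y' h \<bullet> b) * (Z s \<bullet> c)) * ?K (?p /\<^sub>R norm ?p) b c)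
    = (\<lambda>h. cov_deriv k ?p (\<phi>' h) (Y s) (Z s)
        + k ?p (tangent_proj ?p (Y' h)) (Z s) + k ?p (Y s) (tangent_proj ?p (Z' h)))"
    using p T by (simp add: norm_U field exp distrib_right sum.distrib add_ac)
  with der show ?thesis by simp
qed

lemma sphere_deriv_tensor:
  assumes W: "sphere_open W" "W \<subseteq> U" "p \<in> W" and YZ: "vector_field_on W Y" "vector_field_on W Z"
    and x: "x \<in> tangent_space p"
  shows "sphere_deriv (\<lambda>q. k q (Y q) (Z q)) p x = cov_deriv k p x (Y p) (Z p)
    + k p (tangent_proj p (sphere_deriv Y p x)) (Z p) + k p (Y p) (tangent_proj p (sphere_deriv Z p x))"
proof -
  have p: "norm p = 1" using sphere_open_norm W by blast
  have sm: "sphere_smooth_on W Y" "sphere_smooth_on W Z" using YZ by (auto simp: vector_field_on_def)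
  have "((\<lambda>x. k (x /\<^sub>R norm x) (Y (x /\<^sub>R norm x)) (Z (x /\<^sub>R norm x))) has_derivative
     (\<lambda>h. cov_deriv k (p /\<^sub>R norm p) (tangent_proj p h) (Y (p /\<^sub>R norm p)) (Z (p /\<^sub>R norm p))
    + k (p /\<^sub>R norm p) (tangent_proj (p /\<^sub>R norm p) (sphere_deriv Y p h)) (Z (p /\<^sub>R norm p))
    + k (p /\<^sub>R norm p) (Y (p /\<^sub>R norm p)) (tangent_proj (p /\<^sub>R norm p) (sphere_deriv Z p h)))) (at p)"
    by (rule has_derivative_tensor[OF has_derivative_radial[OF p] sphere_has_derivative[OF W(1,3) sm(1)]
          sphere_has_derivative[OF W(1,3) sm(2)] open_cone_over[OF W(1)] mem_cone_over[OF W(1,3)]])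
      (use W YZ in \<open>auto simp: vector_field_on_def\<close>)
  from fun_cong[OF sphere_deriv_eqI[OF this], of x] show ?thesis using p x by simp
qed

text \<open>In the Koszul formula the derivatives of \<open>X\<close> and \<open>Z\<close> cancel against the Lie brackets, which
  shows that it is tensorial in \<open>Z\<close>.\<close>

lemma koszul_eq:
  assumes W: "sphere_open W" "W \<subseteq> U" "p \<in> W"
    and fields: "vector_field_on W X" "vector_field_on W Y" "vector_field_on W Z"
  shows "koszul k X Y Z p = (cov_deriv k p (X p) (Y p) (Z p) + cov_deriv k p (Y p) (X p) (Z p)
      - cov_deriv k p (Z p) (X p) (Y p)) / 2 + k p (tangent_proj p (sphere_deriv Y p (X p))) (Z p)"
proof -
  have t: "X p \<in> tangent_space p" "Y p \<in> tangent_space p" "Z p \<in> tangent_space p"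
    using fields W by (auto simp: vector_field_on_def)
  have p: "p \<in> U" "norm p = 1" using W norm_U by auto
  have tp: "tangent_proj p v \<in> tangent_space p" for v using p by simp
  note d = sphere_deriv_tensor[OF W]
  note s = tensor_sym[OF p(1) t(1) tp] tensor_sym[OF p(1) t(2) tp] tensor_sym[OF p(1) t(3) tp]
  show ?thesis
    unfolding koszul_def lie_bracket_tangent[OF W(1,3) fields(1,2)] lie_bracket_tangent[OF W(1,3) fields(1,3)]
      lie_bracket_tangent[OF W(1,3) fields(2,3)]
    using fields t by (simp add: d tensor_diff[OF p(1) tp tp] s field_simps)
qed

end

locale sphere_metric = sphere_tensor +
  assumes pos_def: "positive_definite_on U k"
begin

lemma form: "p \<in> U \<Longrightarrow> pos_def_form (tangent_space p) (k p)"
  using pos_def subspace_tangent_space[of p] tensor_sym tensor_add tensor_scale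
  by unfold_locales (auto simp: positive_definite_on_def)

text \<open>The right-hand side consists of the difference tensor between the connection of \<open>k\<close> and the round connection, and
  of the round covariant derivative of \<open>Y\<close> in the direction of \<open>X\<close>.\<close>

lemma levi_civita:
  assumes W: "sphere_open W" "W \<subseteq> U" "p \<in> W"
    and fields: "vector_field_on W X" "vector_field_on W Y"
  shows levi_civita_tangent: "levi_civita W k X Y p \<in> tangent_space p"
    and levi_civita_eq: "\<And>z. z \<in> tangent_space p \<Longrightarrow> k p (levi_civita W k X Y p) z =
      (cov_deriv k p (X p) (Y p) z + cov_deriv k p (Y p) (X p) z
      - cov_deriv k p z (X p) (Y p)) / 2 + k p (tangent_proj p (sphere_deriv Y p (X p))) z"
proof -
  have p: "p \<in> U" "norm p = 1" using W norm_U by auto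
  interpret form: pos_def_form "tangent_space p" "k p" by (rule form[OF p(1)])
  let ?\<phi> = "\<lambda>z. (cov_deriv k p (X p) (Y p) z + cov_deriv k p (Y p) (X p) z
      - cov_deriv k p z (X p) (Y p)) / 2
      + k p (tangent_proj p (sphere_deriv Y p (X p))) (tangent_proj p z)"
  note lin = linear_cov_deriv1[OF p(1)] linear_cov_deriv3[OF p(1)]
  have lin': "linear (\<lambda>z. k p (tangent_proj p (sphere_deriv Y p (X p))) (tangent_proj p z))"
    using bilinear_tensor[OF p(1)] by (simp add: bilinear_def)
  have "linear ?\<phi>"
    by (rule linearI)
      (simp_all add: linear_add[OF lin(1)] linear_add[OF lin(2)] linear_cmul[OF lin(1)]
        linear_cmul[OF lin(2)] linear_add[OF lin'] linear_cmul[OF lin'] field_simps)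
  then obtain w where w: "w \<in> tangent_space p" "\<And>z. z \<in> tangent_space p \<Longrightarrow> k p w z = ?\<phi> z"
    using form.riesz by blast
  have koszul: "koszul k X Y Z p = ?\<phi> (Z p)" if "vector_field_on W Z" for Z
    using koszul_eq[OF W fields that] that W by (simp add: vector_field_on_def)
  have "levi_civita W k X Y p = w"
    unfolding levi_civita_def
  proof (rule the_equality)
    show "w \<in> tangent_space p \<and> (\<forall>Z. vector_field_on W Z \<longrightarrow> k p w (Z p) = koszul k X Y Z p)"
      using w W koszul by (auto simp: vector_field_on_def)
  next
    fix v assume v: "v \<in> tangent_space p \<and> (\<forall>Z. vector_field_on W Z \<longrightarrow> k p v (Z p) = koszul k X Y Z p)"
    show "v = w"
    proof (rule form.nondegenerate)
      fix z assume z: "z \<in> tangent_space p"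
      have "k p v (tangent_proj p z) = koszul k X Y (\<lambda>q. tangent_proj q z) p"
        using v vector_field_on_tangent_proj[OF W(1)] by blast
      then show "k p v z = k p w z"
        using koszul[OF vector_field_on_tangent_proj[OF W(1), of z]] w(2)[OF z] z by simp
    qed (use v w in auto)
  qed
  then show "levi_civita W k X Y p \<in> tangent_space p"
    "\<And>z. z \<in> tangent_space p \<Longrightarrow> k p (levi_civita W k X Y p) z =
      (cov_deriv k p (X p) (Y p) z + cov_deriv k p (Y p) (X p) z
      - cov_deriv k p z (X p) (Y p)) / 2 + k p (tangent_proj p (sphere_deriv Y p (X p))) z"
    using w by auto
qed

end

lemma sphere_metric_round:
  assumes "sphere_open U"
  shows "sphere_metric U round_metric"
proof
  show "symmetric_tensor_on U round_metric"
    using assms by (auto simp: symmetric_tensor_on_def round_metric_def vector_field_on_def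
        inner_add_left inner_add_right intro: sphere_smooth_on_inner inner_commute)
  show "positive_definite_on U round_metric"
    by (auto simp: positive_definite_on_def round_metric_def)
qed (rule assms)

lemma cov_deriv_round:
  assumes "norm p = 1" "x \<in> tangent_space p" "y \<in> tangent_space p" "z \<in> tangent_space p"
  shows "cov_deriv round_metric p x y z = 0"
proof -
  have "((\<lambda>q. tangent_proj q y \<bullet> tangent_proj q z) has_derivative
     (\<lambda>h. (tangent_proj p y \<bullet> - ((p \<bullet> z) *\<^sub>R h + (h \<bullet> z) *\<^sub>R p))
        + (- ((p \<bullet> y) *\<^sub>R h + (h \<bullet> y) *\<^sub>R p) \<bullet> tangent_proj p z))) (at p)"
    unfolding tangent_proj_def by (auto intro!: derivative_eq_intros)
  from fun_cong[OF sphere_deriv_eqI[OF sphere_has_derivative_ambient[OF assms(1) this]], of x] assms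
  show ?thesis
    by (simp add: cov_deriv_def round_metric_def tangent_space_def inner_commute)
qed

lemma levi_civita_round:
  assumes W: "sphere_open W" "p \<in> W" and fields: "vector_field_on W X" "vector_field_on W Y"
  shows "levi_civita W round_metric X Y p = tangent_proj p (sphere_deriv Y p (X p))"
proof -
  interpret sphere_metric W round_metric by (rule sphere_metric_round[OF W(1)])
  have p: "norm p = 1" using W norm_U by blast
  have t: "X p \<in> tangent_space p" "Y p \<in> tangent_space p"
    using fields W by (auto simp: vector_field_on_def)
  interpret form: pos_def_form "tangent_space p" "round_metric p" by (rule form[OF W(2)])
  show ?thesis
  proof (rule form.nondegenerate)
    show "round_metric p (levi_civita W round_metric X Y p) z =
        round_metric p (tangent_proj p (sphere_deriv Y p (X p))) z" if z: "z \<in> tangent_space p" for z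
      using levi_civita_eq[OF W(1) order_refl W(2) fields z] cov_deriv_round[OF p] t z by simp
  qed (use p levi_civita_tangent[OF W(1) order_refl W(2) fields] in auto)
qed


section \<open>Geodesics of the round metric and Killing tensors\<close>

text \<open>The initial velocity is \<open>v\<close> itself, of any length. As \<open>sgn 0 = 0\<close>, the constant curve is
  included as the case \<open>v = 0\<close>.\<close>

definition great_circle :: "'a::euclidean_space \<Rightarrow> 'a \<Rightarrow> real \<Rightarrow> 'a" where
  "great_circle p v t = cos (norm v * t) *\<^sub>R p + sin (norm v * t) *\<^sub>R sgn v"

lemma great_circle_0 [simp]: "great_circle p v 0 = p"
  by (simp add: great_circle_def)

lemma norm_great_circle:
  assumes "norm p = 1" "v \<in> tangent_space p"
  shows "norm (great_circle p v t) = 1"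
proof (cases "v = 0")
  case False
  have "p \<bullet> sgn v = 0" "sgn v \<bullet> sgn v = 1" "p \<bullet> p = 1"
    using assms False by (auto simp: tangent_space_def sgn_div_norm norm_eq_1[symmetric] dot_square_norm power2_eq_square)
  then have "great_circle p v t \<bullet> great_circle p v t = (cos (norm v * t))\<^sup>2 + (sin (norm v * t))\<^sup>2"
    by (simp add: great_circle_def inner_add_left inner_add_right inner_commute power2_eq_square)
  then show ?thesis by (simp add: norm_eq_1)
qed (use assms in \<open>simp add: great_circle_def\<close>)

lemma smooth_great_circle: "open S \<Longrightarrow> smooth_on S (great_circle p v)"
  unfolding great_circle_def[abs_def] by (rule smooth_on_cos_sin)

lemma great_circle_vector_derivative:
  "(great_circle p v has_vector_derivative
      (cos (norm v * t) *\<^sub>R v - (norm v * sin (norm v * t)) *\<^sub>R p)) (at t)"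
proof -
  have v: "v = norm v *\<^sub>R sgn v" by (cases "v = 0") (auto simp: sgn_div_norm)
  have "(great_circle p v has_vector_derivative
      (cos (norm v * t) *\<^sub>R norm v *\<^sub>R sgn v - (norm v * sin (norm v * t)) *\<^sub>R p)) (at t)"
    unfolding great_circle_def[abs_def] has_vector_derivative_def
    by (auto intro!: derivative_eq_intros simp: algebra_simps)
  with v show ?thesis by simp
qed

lemma great_circle_velocity:
  "velocity (great_circle p v) t = cos (norm v * t) *\<^sub>R v - (norm v * sin (norm v * t)) *\<^sub>R p"
  by (rule vector_derivative_at[OF great_circle_vector_derivative])

lemma great_circle_acceleration:
  "vector_derivative (velocity (great_circle p v)) (at t) = - (norm v)\<^sup>2 *\<^sub>R great_circle p v t"
proof -
  have v: "v = norm v *\<^sub>R sgn v" by (cases "v = 0") (auto simp: sgn_div_norm)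
  have "((\<lambda>t. cos (norm v * t) *\<^sub>R v - (norm v * sin (norm v * t)) *\<^sub>R p) has_vector_derivative
      - (norm v * sin (norm v * t)) *\<^sub>R v - (norm v * norm v * cos (norm v * t)) *\<^sub>R p) (at t)"
    unfolding has_vector_derivative_def
    by (auto intro!: derivative_eq_intros simp: algebra_simps)
  moreover have "- (norm v * sin (norm v * t)) *\<^sub>R v = - ((norm v)\<^sup>2 * sin (norm v * t)) *\<^sub>R sgn v"
    by (subst (2) v) (simp add: power2_eq_square)
  moreover have "- (norm v)\<^sup>2 *\<^sub>R great_circle p v t =
      - ((norm v)\<^sup>2 * sin (norm v * t)) *\<^sub>R sgn v - (norm v * norm v * cos (norm v * t)) *\<^sub>R p"
    by (simp add: great_circle_def power2_eq_square algebra_simps)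
  ultimately have "((\<lambda>t. cos (norm v * t) *\<^sub>R v - (norm v * sin (norm v * t)) *\<^sub>R p) has_vector_derivative
      - (norm v)\<^sup>2 *\<^sub>R great_circle p v t) (at t)"
    by argo
  then show ?thesis
    by (simp add: great_circle_velocity[abs_def] vector_derivative_at)
qed

lemma great_circle_stays_in_open:
  assumes W: "sphere_open W" "p \<in> W" and v: "v \<in> tangent_space p"
  obtains \<epsilon> where "\<epsilon> > 0" "\<And>t. t \<in> {-\<epsilon><..<\<epsilon>} \<Longrightarrow> great_circle p v t \<in> W"
proof -
  obtain T where T: "open T" "W = sphere 0 1 \<inter> T"
    using W(1) unfolding sphere_open_def openin_open by blast
  have "open (great_circle p v -` T)"
    unfolding great_circle_def[abs_def] by (intro open_vimage T continuous_intros)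
  moreover have "0 \<in> great_circle p v -` T" using W T by simp
  ultimately obtain \<epsilon> where \<epsilon>: "\<epsilon> > 0" "ball 0 \<epsilon> \<subseteq> great_circle p v -` T"
    using open_contains_ball by blast
  have "great_circle p v t \<in> W" if "t \<in> {-\<epsilon><..<\<epsilon>}" for t
  proof -
    have "t \<in> ball 0 \<epsilon>" using that by (auto simp: dist_real_def)
    then show ?thesis
      using \<epsilon>(2) T norm_great_circle[OF sphere_open_norm[OF W] v] by auto
  qed
  with \<epsilon>(1) show thesis using that by blast
qed

lemma smooth_curve_derivatives:
  fixes c :: "real \<Rightarrow> 'a::euclidean_space"
  assumes "smooth_on I c" "open I" "t \<in> I"
  shows "(c has_vector_derivative velocity c t) (at t)"
    and "(velocity c has_vector_derivative vector_derivative (velocity c) (at t)) (at t)"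
proof -
  have diff: "c differentiable (at s)" if "s \<in> I" for s
    using smooth_on_imp_has_derivative[OF assms(1) that] differentiableI by blast
  then show "(c has_vector_derivative velocity c t) (at t)"
    using assms(3) vector_derivative_works by blast
  have "Ck_on (Suc (Suc 0)) I c" using assms(1) smooth_on_def by blast
  then have "((\<lambda>s. frechet_derivative c (at s) 1) has_derivative
      frechet_derivative (\<lambda>s. frechet_derivative c (at s) 1) (at t)) (at t)"
    using assms(3) by (simp add: frechet_derivative_works[symmetric])
  then have "(velocity c has_derivative frechet_derivative (\<lambda>s. frechet_derivative c (at s) 1) (at t)) (at t)"
    by (rule has_derivative_transform_within_open[OF _ assms(2,3)])
      (simp add: frechet_derivative_eq_vector_derivative diff)
  then show "(velocity c has_vector_derivative vector_derivative (velocity c) (at t)) (at t)"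
    using vector_derivative_works differentiableI by blast
qed

lemma velocity_tangent:
  assumes "(c has_vector_derivative v) (at t)" "open I" "t \<in> I" "\<And>s. s \<in> I \<Longrightarrow> norm (c s) = 1"
  shows "v \<in> tangent_space (c t)"
proof -
  have "((\<lambda>s. c s \<bullet> c s) has_derivative (\<lambda>h. c t \<bullet> (h *\<^sub>R v) + (h *\<^sub>R v) \<bullet> c t)) (at t)"
    using assms(1) unfolding has_vector_derivative_def by (intro has_derivative_inner)
  moreover have "((\<lambda>s. c s \<bullet> c s) has_derivative (\<lambda>h. 0)) (at t)"
    by (rule has_derivative_transform_within_open[OF has_derivative_const assms(2,3)])
      (use assms(4) in \<open>simp add: norm_eq_1\<close>)
  ultimately have "(\<lambda>h. c t \<bullet> (h *\<^sub>R v) + (h *\<^sub>R v) \<bullet> c t) = (\<lambda>h. 0)"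
    by (rule has_derivative_unique)
  from fun_cong[OF this, of 1] show ?thesis by (simp add: tangent_space_def inner_commute)
qed

text \<open>The correction term in the definition of the covariant derivative along a curve is normal to the sphere
  for the round metric, so its projection vanishes.\<close>

lemma covariant_deriv_along_round:
  assumes "sphere_open U" "c t \<in> U" "velocity c t \<in> tangent_space (c t)" "V t \<in> tangent_space (c t)"
  shows "covariant_deriv_along U round_metric c V t = tangent_proj (c t) (vector_derivative V (at t))"
proof -
  have p: "norm (c t) = 1" using assms sphere_open_norm by blast
  then have "c t \<bullet> c t = 1" by (simp add: norm_eq_1)
  then show ?thesis
    using assms p
    by (simp add: covariant_deriv_along_def levi_civita_round vector_field_on_tangent_proj
        sphere_deriv_tangent_proj tangent_proj_def[of "c t" "- _"] tangent_space_def)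
qed

context sphere_tensor begin

lemma tensor_zero:
  assumes p: "p \<in> U" and w: "w \<in> tangent_space p"
  shows "k p 0 w = 0" "k p w 0 = 0"
  using tensor_scale[OF p w w, of 0] tensor_sym[OF p w subspace_0[OF subspace_tangent_space]] by auto

text \<open>In the Leibniz rule the two terms with the acceleration drop out, as the acceleration of a
  geodesic has no tangential part.\<close>

lemma derivative_along_geodesic:
  assumes geo: "geodesic_on U round_metric I c" and t: "t \<in> I"
  shows "((\<lambda>s. k (c s) (velocity c s) (velocity c s)) has_vector_derivative
      cov_deriv k (c t) (velocity c t) (velocity c t) (velocity c t)) (at t)"
proof -
  have I: "open I" "smooth_on I c" "\<And>s. s \<in> I \<Longrightarrow> c s \<in> U"
    "covariant_deriv_along U round_metric c (velocity c) t = 0"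
    using geo t by (auto simp: geodesic_on_def)
  have tan: "velocity c s \<in> tangent_space (c s)" if "s \<in> I" for s
    using smooth_curve_derivatives(1)[OF I(2,1) that] I(1) that
    by (rule velocity_tangent) (use I norm_U in auto)
  have acc: "tangent_proj (c t) (vector_derivative (velocity c) (at t)) = 0"
    using covariant_deriv_along_round[where V="velocity c", OF open_U I(3)[OF t] tan[OF t] tan[OF t]] I(4) by simp
  have p: "c t \<in> U" using I t by simp
  note zero = tensor_zero[OF p tan[OF t]]
  have "((\<lambda>s. k (c s) (velocity c s) (velocity c s)) has_derivative
      (\<lambda>h. cov_deriv k (c t) (h *\<^sub>R velocity c t) (velocity c t) (velocity c t)
        + k (c t) (tangent_proj (c t) (h *\<^sub>R vector_derivative (velocity c) (at t))) (velocity c t)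
        + k (c t) (velocity c t) (tangent_proj (c t) (h *\<^sub>R vector_derivative (velocity c) (at t))))) (at t)"
    using smooth_curve_derivatives[OF I(2,1) t] I t tan unfolding has_vector_derivative_def
    by (intro has_derivative_tensor[of _ _ _ _ _ _ _ I])
  then show ?thesis
    unfolding has_vector_derivative_def
    by (simp add: linear_cmul[OF linear_tangent_proj] acc zero linear_cmul[OF linear_cov_deriv1[OF p]])
qed

lemma great_circle_geodesic:
  assumes p: "p \<in> U" and v: "v \<in> tangent_space p"
    and \<epsilon>: "\<And>t. t \<in> {-\<epsilon><..<\<epsilon>} \<Longrightarrow> great_circle p v t \<in> U"
  shows "geodesic_on U round_metric {-\<epsilon><..<\<epsilon>} (great_circle p v)"
  unfolding geodesic_on_def
proof (intro conjI ballI)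
  fix t assume t: "t \<in> {-\<epsilon><..<\<epsilon>}"
  let ?c = "great_circle p v"
  have n: "norm (?c s) = 1" for s by (rule norm_great_circle[OF norm_U[OF p] v])
  have vel: "velocity ?c t \<in> tangent_space (?c t)"
    by (rule velocity_tangent[OF _ open_UNIV])
      (auto simp: great_circle_velocity great_circle_vector_derivative n)
  have "tangent_proj (?c t) (?c t) = 0" using n by (simp add: tangent_proj_def norm_eq_1)
  then show "covariant_deriv_along U round_metric ?c (velocity ?c) t = 0"
    by (simp add: covariant_deriv_along_round[where V="velocity ?c", OF open_U \<epsilon>[OF t] vel vel]
        great_circle_acceleration linear_neg[OF linear_tangent_proj] linear_cmul[OF linear_tangent_proj])
qed (use \<epsilon> in \<open>auto simp: is_interval_oo intro: smooth_great_circle[OF open_greaterThanLessThan]\<close>)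

text \<open>One direction tests constancy on great circles, which realise every initial velocity; the other integrates the vanishing
  derivative over an interval.\<close>

lemma killing_tensor_iff:
  "killing_tensor_on U round_metric k \<longleftrightarrow> (\<forall>p\<in>U. \<forall>x\<in>tangent_space p. cov_deriv k p x x x = 0)"
proof (intro iffI ballI)
  fix p x assume kill: "killing_tensor_on U round_metric k" and p: "p \<in> U" and x: "x \<in> tangent_space p"
  let ?c = "great_circle p x"
  obtain \<epsilon> where \<epsilon>: "\<epsilon> > 0" "\<And>t. t \<in> {-\<epsilon><..<\<epsilon>} \<Longrightarrow> ?c t \<in> U"
    using great_circle_stays_in_open[OF open_U p x] by blast
  have geo: "geodesic_on U round_metric {-\<epsilon><..<\<epsilon>} ?c"
    by (rule great_circle_geodesic[OF p x \<epsilon>(2)])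
  then obtain y where y: "\<And>t. t \<in> {-\<epsilon><..<\<epsilon>} \<Longrightarrow> k (?c t) (velocity ?c t) (velocity ?c t) = y"
    using kill unfolding killing_tensor_on_def constant_on_def by blast
  have 0: "0 \<in> {-\<epsilon><..<\<epsilon>}" using \<epsilon> by simp
  have "((\<lambda>t. k (?c t) (velocity ?c t) (velocity ?c t)) has_vector_derivative 0) (at 0)"
    unfolding has_vector_derivative_def
    by (rule has_derivative_transform_within_open[of "\<lambda>t. y" _ _ _ "{-\<epsilon><..<\<epsilon>}"]) (use y 0 in auto)
  moreover have "velocity ?c 0 = x" by (simp add: great_circle_velocity)
  ultimately show "cov_deriv k p x x x = 0"
    using derivative_along_geodesic[OF geo 0] vector_derivative_unique_at by fastforce
next
  assume zero: "\<forall>p\<in>U. \<forall>x\<in>tangent_space p. cov_deriv k p x x x = 0"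
  have "(\<lambda>t. k (c t) (velocity c t) (velocity c t)) constant_on I"
    if geo: "geodesic_on U round_metric I c" for I c
  proof -
    have I: "open I" "smooth_on I c" "\<And>s. s \<in> I \<Longrightarrow> c s \<in> U" "convex I"
      using geo by (auto simp: geodesic_on_def is_interval_convex)
    have "((\<lambda>s. k (c s) (velocity c s) (velocity c s)) has_derivative (\<lambda>h. 0)) (at t within I)"
      if t: "t \<in> I" for t
    proof -
      have "velocity c t \<in> tangent_space (c t)"
        using smooth_curve_derivatives(1)[OF I(2,1) t] I(1) t
        by (rule velocity_tangent) (use I norm_U in auto)
      then show ?thesis
        using derivative_along_geodesic[OF geo t] zero I(3)[OF t]
        by (auto simp: has_vector_derivative_def intro: has_derivative_at_withinI)
    qed
    from has_derivative_zero_constant[OF I(4) this] show ?thesis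
      unfolding constant_on_def by blast
  qed
  then show "killing_tensor_on U round_metric k"
    using tensor by (simp add: killing_tensor_on_def)
qed

end


section \<open>Mean curvature of the equators\<close>

abbreviation equator :: "'a::euclidean_space \<Rightarrow> 'a set" where
  "equator a \<equiv> sphere 0 1 \<inter> {x. a \<bullet> x = 0}"

text \<open>The defining function \<open>q \<mapsto> a \<bullet> q\<close> is critical on the sphere only at the two poles, where \<open>q\<close> is a
  multiple of \<open>a\<close>. The neighbourhood below removes them: on the sphere, \<open>a \<bullet> a - (a \<bullet> q)\<^sup>2\<close> is the squared
  length of the projection of \<open>a\<close>.\<close>

lemma hypersurface_of_equator:
  assumes U: "sphere_open U" and a: "a \<noteq> 0"
  shows "hypersurface_of U (equator a \<inter> U)"
  unfolding hypersurface_of_def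
proof (intro conjI ballI)
  fix p assume p: "p \<in> equator a \<inter> U"
  let ?W = "{q \<in> U. a \<bullet> a - (a \<bullet> q)\<^sup>2 \<noteq> 0}"
  have W: "sphere_open ?W"
    by (rule sphere_open_continuous_nonzero[OF U]) (intro continuous_intros)
  have deriv: "sphere_deriv (\<lambda>q. a \<bullet> q) q v = a \<bullet> tangent_proj q v" if "q \<in> ?W" for q v
  proof -
    have "((\<lambda>q. a \<bullet> q) has_derivative (\<lambda>h. a \<bullet> h)) (at q)" by (auto intro!: derivative_eq_intros)
    from sphere_deriv_eqI[OF sphere_has_derivative_ambient[OF sphere_open_norm[OF W that] this]]
    show ?thesis by simp
  qed
  have "\<exists>v\<in>tangent_space q. sphere_deriv (\<lambda>q. a \<bullet> q) q v \<noteq> 0" if q: "q \<in> ?W" for q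
  proof
    have n: "norm q = 1" using sphere_open_norm[OF W q] .
    then show tan: "tangent_proj q a \<in> tangent_space q" by simp
    show "sphere_deriv (\<lambda>q. a \<bullet> q) q (tangent_proj q a) \<noteq> 0"
      using q tan by (simp add: deriv[OF q])
        (simp add: tangent_proj_def inner_diff_right power2_eq_square inner_commute)
  qed
  moreover have "sphere_smooth_on ?W (\<lambda>q. a \<bullet> q)"
    by (intro sphere_smooth_on_inner sphere_smooth_on_const sphere_smooth_on_ident W)
  moreover have "p \<in> ?W" using p a by auto
  moreover have "equator a \<inter> U \<inter> ?W = {q \<in> ?W. a \<bullet> q = 0}"
    using sphere_open_norm[OF U] by auto
  ultimately show "\<exists>W u. sphere_open W \<and> p \<in> W \<and> W \<subseteq> U \<and> sphere_smooth_on W (u :: 'a \<Rightarrow> real) \<and>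
        equator a \<inter> U \<inter> W = {q \<in> W. u q = 0} \<and> (\<forall>q\<in>W. \<exists>v\<in>tangent_space q. sphere_deriv u q v \<noteq> 0)"
    using W by (intro exI[of _ ?W] exI[of _ "\<lambda>q. a \<bullet> q"]) auto
qed auto

lemma great_circle_in_equator:
  assumes "norm p = 1" "v \<in> tangent_space p" "a \<bullet> p = 0" "a \<bullet> v = 0"
  shows "great_circle p v t \<in> equator a"
  using norm_great_circle[OF assms(1,2)] assms
  by (simp add: great_circle_def inner_add_right sgn_div_norm)

text \<open>Great circles that start tangentially to the equator stay in it.\<close>

lemma tangent_to_equator:
  assumes U: "sphere_open U" and p: "p \<in> equator a \<inter> U"
  shows "tangent_to (equator a \<inter> U) p = {v \<in> tangent_space p. a \<bullet> v = 0}"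
proof (intro equalityI subsetI)
  fix v assume "v \<in> tangent_to (equator a \<inter> U) p"
  then obtain c \<epsilon> where c: "\<epsilon> > 0" "c ` {-\<epsilon><..<\<epsilon>} \<subseteq> equator a \<inter> U" "c 0 = p"
    "(c has_vector_derivative v) (at 0)"
    unfolding tangent_to_def by blast
  have on: "norm (c s) = 1" "a \<bullet> c s = 0" if "s \<in> {-\<epsilon><..<\<epsilon>}" for s
  proof -
    have "c s \<in> equator a" using c(2) that by blast
    then show "norm (c s) = 1" "a \<bullet> c s = 0" by auto
  qed
  have 0: "0 \<in> {-\<epsilon><..<\<epsilon>}" using c(1) by simp
  have "v \<in> tangent_space p"
    using velocity_tangent[OF c(4) _ 0 on(1)] c(3) by simp
  moreover have "a \<bullet> v = 0"
  proof -
    have "((\<lambda>s. a \<bullet> c s) has_derivative (\<lambda>h. a \<bullet> (h *\<^sub>R v))) (at 0)"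
      using c(4) unfolding has_vector_derivative_def by (rule has_derivative_inner_right)
    moreover have "((\<lambda>s. a \<bullet> c s) has_derivative (\<lambda>h. 0)) (at 0)"
      by (rule has_derivative_transform_within_open[OF has_derivative_const[where c=0] _ 0]) (auto simp: on)
    ultimately have "(\<lambda>h. a \<bullet> (h *\<^sub>R v)) = (\<lambda>h. 0)" by (rule has_derivative_unique)
    from fun_cong[OF this, of 1] show ?thesis by simp
  qed
  ultimately show "v \<in> {v \<in> tangent_space p. a \<bullet> v = 0}" by simp
next
  fix v assume v: "v \<in> {v \<in> tangent_space p. a \<bullet> v = 0}"
  have pU: "p \<in> U" "norm p = 1" using p by auto
  obtain \<epsilon> where \<epsilon>: "\<epsilon> > 0" "\<And>t. t \<in> {-\<epsilon><..<\<epsilon>} \<Longrightarrow> great_circle p v t \<in> U"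
    using great_circle_stays_in_open[OF U pU(1)] v by blast
  have "great_circle p v t \<in> equator a" for t
    using great_circle_in_equator[OF pU(2)] v p by blast
  then have "great_circle p v ` {-\<epsilon><..<\<epsilon>} \<subseteq> equator a \<inter> U" using \<epsilon> by blast
  moreover have "(great_circle p v has_vector_derivative v) (at 0)"
    using great_circle_vector_derivative[of p v 0] by simp
  ultimately show "v \<in> tangent_to (equator a \<inter> U) p"
    unfolding tangent_to_def using \<epsilon>(1) smooth_great_circle[OF open_greaterThanLessThan]
    by (intro CollectI exI[of _ "great_circle p v"] exI[of _ \<epsilon>]) simp
qed

text \<open>This is where equators are totally geodesic for the round metric: along a great circle inside the equator the field \<open>Y\<close>
  stays perpendicular to the fixed vector \<open>a\<close>, and so does its derivative.\<close>

lemma sphere_deriv_tangential_field: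
  assumes U: "sphere_open U" and W: "sphere_open W" "W \<subseteq> U" "p \<in> W" "p \<in> equator a"
    and Y: "vector_field_on W Y" "\<And>q. q \<in> equator a \<inter> U \<inter> W \<Longrightarrow> Y q \<in> tangent_to (equator a \<inter> U) q"
    and x: "x \<in> tangent_space p" "a \<bullet> x = 0"
  shows "a \<bullet> sphere_deriv Y p x = 0"
proof -
  let ?c = "great_circle p x"
  have n: "norm p = 1" using W by simp
  obtain \<epsilon> where \<epsilon>: "\<epsilon> > 0" "\<And>t. t \<in> {-\<epsilon><..<\<epsilon>} \<Longrightarrow> ?c t \<in> W"
    using great_circle_stays_in_open[OF W(1,3) x(1)] by blast
  have eq: "?c t \<in> equator a" for t using great_circle_in_equator[OF n x(1)] W x by blast
  have 0: "0 \<in> {-\<epsilon><..<\<epsilon>}" using \<epsilon> by simp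
  have sm: "sphere_smooth_on W Y" using Y by (simp add: vector_field_on_def)
  have "((\<lambda>s. Y (?c s)) has_vector_derivative sphere_deriv Y p x) (at 0)"
  proof (rule sphere_deriv_along_curve[where c="?c" and f=Y and D="sphere_deriv Y p" and I=UNIV])
    show "((\<lambda>x. Y (x /\<^sub>R norm x)) has_derivative sphere_deriv Y p) (at (?c 0))"
      using sphere_has_derivative[OF W(1,3) sm] by simp
    show "(?c has_vector_derivative x) (at 0)"
      using great_circle_vector_derivative[of p x 0] by simp
  qed (use norm_great_circle[OF n x(1)] in auto)
  then have "((\<lambda>s. a \<bullet> Y (?c s)) has_derivative (\<lambda>h. a \<bullet> (h *\<^sub>R sphere_deriv Y p x))) (at 0)"
    unfolding has_vector_derivative_def by (rule has_derivative_inner_right)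
  moreover have "((\<lambda>s. a \<bullet> Y (?c s)) has_derivative (\<lambda>h. 0)) (at 0)"
  proof -
  have vanish: "a \<bullet> Y (?c t) = 0" if "t \<in> {-\<epsilon><..<\<epsilon>}" for t
  proof -
    have mem: "?c t \<in> equator a \<inter> U" "?c t \<in> W" using eq \<epsilon>(2)[OF that] W(2) by auto
    then show ?thesis using Y(2)[of "?c t"] tangent_to_equator[OF U mem(1)] by auto
  qed
  show ?thesis
    by (rule has_derivative_transform_within_open[OF has_derivative_const[where c=0] _ 0]) (auto simp: vanish)
  qed
  ultimately have "(\<lambda>h. a \<bullet> (h *\<^sub>R sphere_deriv Y p x)) = (\<lambda>h. 0)" by (rule has_derivative_unique)
  from fun_cong[OF this, of 1] show ?thesis by simp
qed

lemma (in pos_def_form) pos_def_form_subspace: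
  "subspace W \<Longrightarrow> W \<subseteq> V \<Longrightarrow> pos_def_form W b"
  by unfold_locales (auto simp: subset_iff sym add_left scale_left pos)

context sphere_metric begin

text \<open>The round covariant derivative of a tangential field is tangential, so that
  pairing with \<open>\<nu>\<close> leaves only the difference tensor; in particular the value is the same for all fields that extend
  \<open>v\<close> and \<open>w\<close>. The projections of the constant vectors \<open>v\<close> and \<open>w\<close> are such fields.\<close>

lemma second_fundamental_form_equator:
  assumes p: "p \<in> equator a \<inter> U" and \<nu>: "unit_normal k (equator a \<inter> U) p \<nu>"
    and v: "v \<in> tangent_to (equator a \<inter> U) p" and w: "w \<in> tangent_to (equator a \<inter> U) p"
  shows "second_fundamental_form U k (equator a \<inter> U) p \<nu> v w =
    (cov_deriv k p v w \<nu> + cov_deriv k p w v \<nu> - cov_deriv k p \<nu> v w) / 2"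
proof -
  let ?\<Sigma> = "equator a \<inter> U"
  let ?I = "(cov_deriv k p v w \<nu> + cov_deriv k p w v \<nu> - cov_deriv k p \<nu> v w) / 2"
  have pU: "p \<in> U" "norm p = 1" using p by auto
  note tangent_to = tangent_to_equator[OF open_U]
  have vw: "v \<in> tangent_space p" "a \<bullet> v = 0" "w \<in> tangent_space p"
    using v w tangent_to[OF p] by auto
  have \<nu>': "\<nu> \<in> tangent_space p" "\<And>u. u \<in> tangent_to ?\<Sigma> p \<Longrightarrow> k p \<nu> u = 0"
    using \<nu> by (auto simp: unit_normal_def)
  have value_eq: "k p (levi_civita W k X Y p) \<nu> = ?I"
    if W: "sphere_open W" "p \<in> W" "W \<subseteq> U" and XY: "vector_field_on W X" "vector_field_on W Y"
      and tan: "\<forall>q\<in>?\<Sigma> \<inter> W. X q \<in> tangent_to ?\<Sigma> q \<and> Y q \<in> tangent_to ?\<Sigma> q"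
      and val: "X p = v" "Y p = w" for W X Y
  proof -
    have "a \<bullet> sphere_deriv Y p v = 0"
      by (rule sphere_deriv_tangential_field[OF open_U W(1,3,2) _ XY(2)]) (use p tan vw in auto)
    then have "tangent_proj p (sphere_deriv Y p v) \<in> tangent_to ?\<Sigma> p"
      using tangent_to[OF p] p pU
      by (simp add: tangent_proj_def[of p "sphere_deriv Y p v"] inner_diff_right tangent_space_def norm_eq_1)
    then have "k p (tangent_proj p (sphere_deriv Y p v)) \<nu> = 0"
      using \<nu>' tensor_sym[OF pU(1) _ \<nu>'(1)] tangent_to[OF p] by simp
    then show ?thesis
      using levi_civita_eq[OF W(1,3,2) XY \<nu>'(1)] val by simp
  qed
  show ?thesis unfolding second_fundamental_form_def
  proof (rule the_equality)
    have tan: "tangent_proj q u \<in> tangent_to ?\<Sigma> q" if "q \<in> ?\<Sigma>" "a \<bullet> u = 0" for q u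
      using that by (simp add: tangent_to[OF that(1)]) (simp add: tangent_proj_def inner_diff_right)
    have "a \<bullet> w = 0" using w tangent_to[OF p] by simp
    then have *: "\<forall>q\<in>?\<Sigma> \<inter> U. tangent_proj q v \<in> tangent_to ?\<Sigma> q \<and> tangent_proj q w \<in> tangent_to ?\<Sigma> q"
      using tan vw by blast
    note f = vector_field_on_tangent_proj[OF open_U]
    show "\<exists>W X Y. sphere_open W \<and> p \<in> W \<and> W \<subseteq> U \<and> vector_field_on W X \<and> vector_field_on W Y \<and>
        (\<forall>q\<in>?\<Sigma> \<inter> W. X q \<in> tangent_to ?\<Sigma> q \<and> Y q \<in> tangent_to ?\<Sigma> q) \<and>
        X p = v \<and> Y p = w \<and> ?I = k p (levi_civita W k X Y p) \<nu>"
      using value_eq[OF open_U pU(1) order_refl f f *] pU open_U f * vw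
      by (intro exI[of _ U] exI[of _ "\<lambda>q. tangent_proj q v"] exI[of _ "\<lambda>q. tangent_proj q w"]) simp
  qed (use value_eq in blast)
qed

text \<open>An orthonormal basis of the tangent space of the equator becomes one of the full tangent space when
  \<open>\<nu>\<close> is added. The summand of \<open>\<nu>\<close> in the full trace accounts for the last term, and the
  full trace can be computed in any basis.\<close>

lemma mean_curvature_equator:
  assumes p: "p \<in> equator a \<inter> U" and a: "a \<noteq> 0" and \<nu>: "unit_normal k (equator a \<inter> U) p \<nu>"
    and C: "orthonormal_basis (k p) (tangent_space p) C"
  shows "2 * mean_curvature U k (equator a \<inter> U) p \<nu> =
    2 * (\<Sum>e\<in>C. cov_deriv k p e e \<nu>) - (\<Sum>e\<in>C. cov_deriv k p \<nu> e e) - cov_deriv k p \<nu> \<nu> \<nu>"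
proof -
  let ?\<Sigma> = "equator a \<inter> U"
  have pU: "p \<in> U" "norm p = 1" using p by auto
  interpret form: pos_def_form "tangent_space p" "k p" by (rule form[OF pU(1)])
  note tangent_to = tangent_to_equator[OF open_U p]
  have \<nu>': "\<nu> \<in> tangent_space p" "k p \<nu> \<nu> = 1" "\<And>u. u \<in> tangent_to ?\<Sigma> p \<Longrightarrow> k p \<nu> u = 0"
    using \<nu> by (auto simp: unit_normal_def)
  have a\<nu>: "a \<bullet> \<nu> \<noteq> 0"
    using \<nu>' tangent_to by auto
  \<comment> \<open>the two hyperplanes agree, since \<open>\<nu>\<close> is not tangent to the equator\<close>
  have perp: "tangent_to ?\<Sigma> p = {w \<in> tangent_space p. k p \<nu> w = 0}"
  proof (intro equalityI subsetI)
    fix w assume w: "w \<in> {w \<in> tangent_space p. k p \<nu> w = 0}"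
    let ?r = "a \<bullet> w / (a \<bullet> \<nu>)"
    have t: "w \<in> tangent_space p" "?r *\<^sub>R \<nu> \<in> tangent_space p"
      using w \<nu>'(1) subspace_scale[OF subspace_tangent_space] by auto
    then have "w - ?r *\<^sub>R \<nu> \<in> tangent_space p" by (rule subspace_diff[OF subspace_tangent_space])
    then have u: "w - ?r *\<^sub>R \<nu> \<in> tangent_to ?\<Sigma> p"
      using a\<nu> by (simp add: tangent_to inner_diff_right)
    have "0 = k p (w - ?r *\<^sub>R \<nu>) \<nu>"
      using \<nu>'(3)[OF u] tensor_sym[OF pU(1) \<nu>'(1)] u tangent_to by simp
    also have "\<dots> = - ?r"
      using w \<nu>' t tensor_sym[OF pU(1) t(1) \<nu>'(1)]
      by (simp add: tensor_diff[OF pU(1)] tensor_scale[OF pU(1)])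
    finally show "w \<in> tangent_to ?\<Sigma> p" using a\<nu> t by (simp add: tangent_to)
  qed (use \<nu>'(3) tangent_to in auto)
  have sub: "subspace (tangent_to ?\<Sigma> p)"
    using subspace_inter[OF subspace_tangent_space subspace_hyperplane, of p a]
    unfolding tangent_to by (simp add: Int_def)
  interpret hyper: pos_def_form "tangent_to ?\<Sigma> p" "k p"
    by (rule form.pos_def_form_subspace[OF sub]) (auto simp: tangent_to)
  let ?B = "SOME B. orthonormal_basis (k p) (tangent_to ?\<Sigma> p) B"
  have B: "orthonormal_basis (k p) (tangent_to ?\<Sigma> p) ?B"
    by (rule someI_ex[OF hyper.orthonormal_basis_exists])
  then have BT: "?B \<subseteq> tangent_to ?\<Sigma> p" by (simp add: orthonormal_basis_def)
  note ins = form.orthonormal_basis_insert_normal[OF \<nu>'(1,2) B[unfolded perp], folded perp]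
  have fin: "finite ?B" using B hyper.orthonormal_basis_iff hyper.orthonormal_finite by blast
  have "2 * mean_curvature U k ?\<Sigma> p \<nu> = (\<Sum>e\<in>?B. 2 * second_fundamental_form U k ?\<Sigma> p \<nu> e e)"
    by (simp add: mean_curvature_def sum_distrib_left)
  also have "\<dots> = (\<Sum>e\<in>?B. 2 * cov_deriv k p e e \<nu> - cov_deriv k p \<nu> e e)"
    using BT by (intro sum.cong) (auto simp: second_fundamental_form_equator[OF p \<nu>])
  also have "\<dots> = (\<Sum>e\<in>insert \<nu> ?B. 2 * cov_deriv k p e e \<nu> - cov_deriv k p \<nu> e e) - cov_deriv k p \<nu> \<nu> \<nu>"
    using ins(1) fin by simp
  also have "(\<Sum>e\<in>insert \<nu> ?B. 2 * cov_deriv k p e e \<nu> - cov_deriv k p \<nu> e e) =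
      (\<Sum>e\<in>C. 2 * cov_deriv k p e e \<nu> - cov_deriv k p \<nu> e e)"
  proof (rule form.trace_basis_independent[where \<beta>="\<lambda>x y. 2 * cov_deriv k p x y \<nu> - cov_deriv k p \<nu> x y", OF _ ins(2) C])
    note lin = linear_cov_deriv1[OF pU(1)] linear_cov_deriv2[OF pU(1)] linear_cov_deriv3[OF pU(1)]
    note simps = linear_add[OF lin(1)] linear_add[OF lin(2)] linear_add[OF lin(3)]
      linear_cmul[OF lin(1)] linear_cmul[OF lin(2)] linear_cmul[OF lin(3)]
    show "bilinear (\<lambda>x y. 2 * cov_deriv k p x y \<nu> - cov_deriv k p \<nu> x y)"
      unfolding bilinear_def by (auto intro!: linearI simp: simps algebra_simps)
  qed
  also have "\<dots> = 2 * (\<Sum>e\<in>C. cov_deriv k p e e \<nu>) - (\<Sum>e\<in>C. cov_deriv k p \<nu> e e)"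
    by (simp add: sum_subtractf sum_distrib_left)
  finally show ?thesis .
qed

text \<open>The vector \<open>a\<close> represents the linear form \<open>w \<mapsto> k(\<nu>, w)\<close> with respect to the ambient inner product.\<close>

lemma unit_normal_equator_exists:
  assumes p: "p \<in> U" and \<nu>: "\<nu> \<in> tangent_space p" "k p \<nu> \<nu> = 1"
  obtains a where "a \<noteq> 0" "p \<in> equator a" "unit_normal k (equator a \<inter> U) p \<nu>"
proof -
  have "linear (\<lambda>w. k p (tangent_proj p \<nu>) (tangent_proj p w))"
    using bilinear_tensor[OF p] by (simp add: bilinear_def)
  then have lin: "linear (\<lambda>w. k p \<nu> (tangent_proj p w))" using \<nu>(1) by simp
  have n: "norm p = 1" by (rule norm_U[OF p])
  define a where "a = (\<Sum>b\<in>Basis. k p \<nu> (tangent_proj p b) *\<^sub>R b)"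
  have a: "a \<bullet> w = k p \<nu> (tangent_proj p w)" for w
  proof -
    have "k p \<nu> (tangent_proj p w) = k p \<nu> (tangent_proj p (\<Sum>b\<in>Basis. (w \<bullet> b) *\<^sub>R b))"
      by (simp add: euclidean_representation)
    also have "\<dots> = (\<Sum>b\<in>Basis. (w \<bullet> b) * k p \<nu> (tangent_proj p b))"
      by (simp add: linear_sum[OF lin] linear_cmul[OF lin])
    finally show ?thesis
      by (simp add: a_def inner_sum_left inner_commute[of w] mult.commute)
  qed
  have "a \<bullet> \<nu> = 1" using a \<nu> by simp
  moreover have "a \<bullet> p = 0"
    using a[of p] n tensor_zero[OF p \<nu>(1)] by (simp add: tangent_proj_def norm_eq_1)
  moreover from this have "k p \<nu> w = 0" if "w \<in> tangent_to (equator a \<inter> U) p" for w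
    using that tangent_to_equator[OF open_U, of p a] a[of w] p n by auto
  ultimately show thesis
    using \<nu> n by (intro that[of a]) (auto simp: unit_normal_def)
qed

text \<open>At unit vectors this is the vanishing of the mean curvature of some equator with that normal; both
  sides are homogeneous of degree three in \<open>x\<close>.\<close>

lemma equators_minimal_iff:
  "equators_minimal U k \<longleftrightarrow>
    (\<forall>p\<in>U. \<forall>B. orthonormal_basis (k p) (tangent_space p) B \<longrightarrow> (\<forall>x\<in>tangent_space p.
      cov_deriv k p x x x =
        (2 * (\<Sum>e\<in>B. cov_deriv k p e e x) - (\<Sum>e\<in>B. cov_deriv k p x e e)) * k p x x))"
proof (intro iffI ballI allI impI)
  fix p B x assume min: "equators_minimal U k" and p: "p \<in> U" and x: "x \<in> tangent_space p"
    and B: "orthonormal_basis (k p) (tangent_space p) B"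
  interpret form: pos_def_form "tangent_space p" "k p" by (rule form[OF p])
  note lin = linear_cov_deriv1[OF p] linear_cov_deriv2[OF p] linear_cov_deriv3[OF p]
  note cmul = linear_cmul[OF lin(1)] linear_cmul[OF lin(2)] linear_cmul[OF lin(3)]
  show "cov_deriv k p x x x =
        (2 * (\<Sum>e\<in>B. cov_deriv k p e e x) - (\<Sum>e\<in>B. cov_deriv k p x e e)) * k p x x"
  proof (cases "x = 0")
    case True
    then show ?thesis using linear_0[OF lin(1)] tensor_zero[OF p x] by simp
  next
    case False
    then have pos: "k p x x > 0" using form.pos x by blast
    define s where "s = sqrt (k p x x)"
    define \<nu> where "\<nu> = (1 / s) *\<^sub>R x"
    have s: "s > 0" "s * s = k p x x" using pos by (auto simp: s_def)
    have \<nu>: "\<nu> \<in> tangent_space p" "x = s *\<^sub>R \<nu>"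
      using x s by (auto simp: \<nu>_def subspace_scale[OF subspace_tangent_space])
    have "k p x x = s * (s * k p \<nu> \<nu>)"
      using \<nu> tensor_scale[OF p \<nu>(1) x, of s] tensor_scale[OF p \<nu>(1) \<nu>(1), of s] tensor_sym[OF p \<nu>(1) x] by simp
    then have "(s * s) * k p \<nu> \<nu> = (s * s) * 1" using s by simp
    then have unit: "k p \<nu> \<nu> = 1" using s(1) by simp
    obtain a where a: "a \<noteq> 0" "p \<in> equator a" "unit_normal k (equator a \<inter> U) p \<nu>"
      using unit_normal_equator_exists[OF p \<nu>(1) unit] .
    have pe: "p \<in> equator a \<inter> U" using a p by blast
    have "minimal_hypersurface U k (equator a \<inter> U)"
      using min a(1) unfolding equators_minimal_def equators_def by blast
    then have "mean_curvature U k (equator a \<inter> U) p \<nu> = 0"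
      using a pe by (auto simp: minimal_hypersurface_def)
    then have "cov_deriv k p \<nu> \<nu> \<nu> = 2 * (\<Sum>e\<in>B. cov_deriv k p e e \<nu>) - (\<Sum>e\<in>B. cov_deriv k p \<nu> e e)"
      using mean_curvature_equator[OF pe a(1,3) B] by simp
    moreover have "cov_deriv k p x x x = s * (s * s) * cov_deriv k p \<nu> \<nu> \<nu>"
      by (simp add: \<nu>(2) cmul)
    moreover have "2 * (\<Sum>e\<in>B. cov_deriv k p e e x) - (\<Sum>e\<in>B. cov_deriv k p x e e) =
        s * (2 * (\<Sum>e\<in>B. cov_deriv k p e e \<nu>) - (\<Sum>e\<in>B. cov_deriv k p \<nu> e e))"
      by (simp add: \<nu>(2) cmul sum_distrib_left[symmetric] algebra_simps)
    ultimately show ?thesis by (simp add: s(2))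
  qed
next
  assume cond: "\<forall>p\<in>U. \<forall>B. orthonormal_basis (k p) (tangent_space p) B \<longrightarrow> (\<forall>x\<in>tangent_space p.
      cov_deriv k p x x x =
        (2 * (\<Sum>e\<in>B. cov_deriv k p e e x) - (\<Sum>e\<in>B. cov_deriv k p x e e)) * k p x x)"
  have "minimal_hypersurface U k (equator a \<inter> U)" if a: "a \<noteq> 0" for a
    unfolding minimal_hypersurface_def
  proof (intro conjI ballI allI impI)
    show "hypersurface_of U (equator a \<inter> U)" by (rule hypersurface_of_equator[OF open_U a])
    fix p \<nu> assume p: "p \<in> equator a \<inter> U" and \<nu>: "unit_normal k (equator a \<inter> U) p \<nu>"
    have pU: "p \<in> U" using p by simp
    interpret form: pos_def_form "tangent_space p" "k p" by (rule form[OF pU])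
    obtain B where B: "orthonormal_basis (k p) (tangent_space p) B"
      using form.orthonormal_basis_exists by blast
    have "\<nu> \<in> tangent_space p" "k p \<nu> \<nu> = 1" using \<nu> by (auto simp: unit_normal_def)
    then have "cov_deriv k p \<nu> \<nu> \<nu> = 2 * (\<Sum>e\<in>B. cov_deriv k p e e \<nu>) - (\<Sum>e\<in>B. cov_deriv k p \<nu> e e)"
      using cond pU B by simp
    then show "mean_curvature U k (equator a \<inter> U) p \<nu> = 0"
      using mean_curvature_equator[OF p a \<nu> B] by simp
  qed
  then show "equators_minimal U k" unfolding equators_minimal_def equators_def by blast
qed

end


section \<open>The volume ratio and its derivative\<close>

lemma has_derivative_det:
  fixes f :: "'n::finite \<Rightarrow> 'n \<Rightarrow> 'a::real_normed_vector \<Rightarrow> real"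
  assumes "\<And>i j. (f i j has_derivative f' i j) (at s)"
  shows "((\<lambda>t. det (\<chi> i j. f i j t)) has_derivative
    (\<lambda>h. \<Sum>\<sigma> | \<sigma> permutes UNIV. of_int (sign \<sigma>) *
      (\<Sum>i\<in>UNIV. f' i (\<sigma> i) h * (\<Prod>j\<in>UNIV - {i}. f j (\<sigma> j) s)))) (at s)"
proof -
  have "((\<lambda>t. \<Sum>\<sigma> | \<sigma> permutes UNIV. of_int (sign \<sigma>) * (\<Prod>i\<in>UNIV. f i (\<sigma> i) t)) has_derivative
    (\<lambda>h. \<Sum>\<sigma> | \<sigma> permutes UNIV. of_int (sign \<sigma>) *
      (\<Sum>i\<in>UNIV. f' i (\<sigma> i) h * (\<Prod>j\<in>UNIV - {i}. f j (\<sigma> j) s)))) (at s)"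
    by (intro has_derivative_sum has_derivative_mult_right has_derivative_prod assms)
  then show ?thesis by (simp add: det_def)
qed

text \<open>In the Leibniz expansion only the identity permutation contributes: any other permutation moves at least
  two indices, so each summand of the derivative keeps an off-diagonal entry, which vanishes.\<close>

lemma has_derivative_det_at_identity:
  fixes f :: "'n::finite \<Rightarrow> 'n \<Rightarrow> 'a::real_normed_vector \<Rightarrow> real"
  assumes "\<And>i j. (f i j has_derivative f' i j) (at s)" and id: "(\<chi> i j. f i j s) = mat 1"
  shows "((\<lambda>t. det (\<chi> i j. f i j t)) has_derivative (\<lambda>h. \<Sum>i\<in>UNIV. f' i i h)) (at s)"
proof -
  have f: "f i j s = (if i = j then 1 else 0)" for i j
    using id by (simp add: vec_eq_iff mat_def)
  have only_id: "(\<Sum>i\<in>UNIV. f' i (\<sigma> i) h * (\<Prod>j\<in>UNIV - {i}. f j (\<sigma> j) s)) =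
      (if \<sigma> = id then \<Sum>i\<in>UNIV. f' i i h else 0)" if \<sigma>: "\<sigma> permutes UNIV" for \<sigma> h
  proof (cases "\<sigma> = id")
    case False
    have zero: "(\<Prod>j\<in>UNIV - {i}. f j (\<sigma> j) s) = 0" for i
    proof -
      have "\<exists>j\<in>UNIV - {i}. \<sigma> j \<noteq> j"
      proof (rule ccontr)
        assume *: "\<not> ?thesis"
        then have fix_j: "\<sigma> j = j" if "j \<noteq> i" for j using that by blast
        then have "\<sigma> i = i" using permutes_inj[OF \<sigma>] by (metis injD)
        with fix_j show False using False by (metis eq_id_iff)
      qed
      then obtain j where "j \<in> UNIV - {i}" "f j (\<sigma> j) s = 0" by (metis f)
      then show ?thesis by (intro prod_zero) auto
    qed
    show ?thesis unfolding zero using False by simp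
  qed (simp add: f)
  have "(\<lambda>h. \<Sum>\<sigma> | \<sigma> permutes UNIV. of_int (sign \<sigma>) *
      (\<Sum>i\<in>UNIV. f' i (\<sigma> i) h * (\<Prod>j\<in>UNIV - {i}. f j (\<sigma> j) s))) =
    (\<lambda>h. \<Sum>\<sigma> | \<sigma> permutes (UNIV :: 'n set). if \<sigma> = id then \<Sum>i\<in>UNIV. f' i i h else 0)"
    by (intro ext, rule sum.cong) (auto simp: only_id)
  also have "\<dots> = (\<lambda>h. \<Sum>i\<in>UNIV. f' i i h)"
    by (simp add: sum.delta permutes_id finite_permutations)
  finally show ?thesis using has_derivative_det[of f f' s, OF assms(1)] by simp
qed

lemma gram_det_nonneg:
  fixes e :: "'n::finite \<Rightarrow> 'a::euclidean_space"
  assumes "pos_def_form V b" "dim V = CARD('n)" "range e \<subseteq> V"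
  shows "det (\<chi> i j. b (e i) (e j)) \<ge> 0"
proof -
  interpret pos_def_form V b by fact
  obtain f :: "'n \<Rightarrow> 'a" where f: "inj f" "orthonormal_basis b V (range f)"
    using orthonormal_frame_exists assms(2) by metis
  show ?thesis
    using gram_det_change_of_frame[OF assms(1,1) f assms(3)] orthonormal_frame_gram[OF f] by simp
qed

context
  fixes U :: "'n::finite ambient set" and k :: "'n ambient tensor2"
  assumes metric: "sphere_metric U k"
begin

interpretation sphere_metric U k by (rule metric)
interpretation round: sphere_metric U round_metric by (rule sphere_metric_round[OF open_U])

lemma volume_ratio_at_iff:
  assumes p: "p \<in> U" and c: "c > 0"
  shows "volume_ratio_at k s p c \<longleftrightarrow> (\<forall>e :: 'n \<Rightarrow> 'n ambient. range e \<subseteq> tangent_space p \<longrightarrow>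
    det (\<chi> i j. k p (e i) (e j)) = c powr (2 * s) * det (\<chi> i j. round_metric p (e i) (e j)))"
proof -
  have "sqrt x = c powr s * sqrt y \<longleftrightarrow> x = c powr (2 * s) * y" if "x \<ge> 0" "y \<ge> 0" for x y
  proof -
    have "c powr s * sqrt y = sqrt (c powr (2 * s) * y)"
      using that by (simp add: real_sqrt_mult powr_half_sqrt[symmetric] powr_powr)
    then show ?thesis by simp
  qed
  then show ?thesis
    using gram_det_nonneg[OF form[OF p] dim_tangent_space[OF norm_U[OF p]]]
      gram_det_nonneg[OF round.form[OF p] dim_tangent_space[OF norm_U[OF p]]]
    unfolding volume_ratio_at_def volume_element_def by meson
qed

lemma volume_ratio_unique:
  assumes p: "p \<in> U" and s: "s > 0" and c: "c > 0" "volume_ratio_at k s p c"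
    and d: "d > 0" "volume_ratio_at k s p d"
  shows "c = d"
proof -
  interpret f: pos_def_form "tangent_space p" "round_metric p" by (rule round.form[OF p])
  obtain f :: "'n \<Rightarrow> 'n ambient" where f: "inj f" "orthonormal_basis (round_metric p) (tangent_space p) (range f)"
    using f.orthonormal_frame_exists[OF dim_tangent_space[OF norm_U[OF p]]] by blast
  have "range f \<subseteq> tangent_space p" using f by (simp add: orthonormal_basis_def)
  then have "c powr (2 * s) = d powr (2 * s)"
    using volume_ratio_at_iff[OF p c(1)] volume_ratio_at_iff[OF p d(1)] c d f.orthonormal_frame_gram[OF f]
    by (metis det_I mult.right_neutral)
  then have "(c powr (2 * s)) powr (1 / (2 * s)) = (d powr (2 * s)) powr (1 / (2 * s))" by simp
  then show ?thesis using s c(1) d(1) by (simp add: powr_powr)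
qed

lemma volume_ratio_exists:
  assumes p: "p \<in> U" and s: "s > 0"
  obtains c where "c > 0" "volume_ratio_at k s p c"
proof -
  obtain r where r: "r > 0" "\<And>e :: 'n \<Rightarrow> 'n ambient. range e \<subseteq> tangent_space p \<Longrightarrow>
      det (\<chi> i j. k p (e i) (e j)) = r * det (\<chi> i j. round_metric p (e i) (e j))"
    using gram_det_ratio[OF round.form[OF p] form[OF p] dim_tangent_space[OF norm_U[OF p]]] by blast
  \<comment> \<open>Gram determinants are the squares of the volume elements, hence the factor \<open>2 * s\<close>\<close>
  let ?c = "r powr (1 / (2 * s))"
  have "?c powr (2 * s) = r" using r s by (simp add: powr_powr)
  then have "volume_ratio_at k s p ?c" using r volume_ratio_at_iff[OF p, of ?c s] by simp
  with r show thesis by (intro that[of ?c]) simp_all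
qed

lemma the_volume_ratio:
  assumes "p \<in> U" "s > 0"
  shows "(THE c. c > 0 \<and> volume_ratio_at k s p c) > 0 \<and>
    volume_ratio_at k s p (THE c. c > 0 \<and> volume_ratio_at k s p c)"
proof -
  obtain c where "c > 0" "volume_ratio_at k s p c" using volume_ratio_exists[OF assms] .
  then have "c > 0 \<and> volume_ratio_at k s p c" by simp
  then show ?thesis
    by (rule theI) (use volume_ratio_unique[OF assms] \<open>c > 0\<close> \<open>volume_ratio_at k s p c\<close> in blast)
qed

context
  fixes F :: "'n ambient \<Rightarrow> real" and s :: real
  assumes s: "s > 0" and F: "\<And>p. p \<in> U \<Longrightarrow> F p > 0" "\<And>p. p \<in> U \<Longrightarrow> volume_ratio_at k s p (F p)"
begin

text \<open>The frame \<open>b\<close> is moved from one tangent space to the other ones by projection. Although the projected frame is not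
  orthonormal at other points, it is smooth, and the quotient of the two Gram determinants recovers the volume
  ratio wherever the frame is non-degenerate.\<close>

private definition metric_gram :: "('n \<Rightarrow> 'n ambient) \<Rightarrow> 'n ambient \<Rightarrow> real" where
  "metric_gram b q = det (\<chi> i j. k q (tangent_proj q (b i)) (tangent_proj q (b j)))"

private definition round_gram :: "('n \<Rightarrow> 'n ambient) \<Rightarrow> 'n ambient \<Rightarrow> real" where
  "round_gram b q = det (\<chi> i j. round_metric q (tangent_proj q (b i)) (tangent_proj q (b j)))"

private lemma metric_gram_eq: "q \<in> U \<Longrightarrow> metric_gram b q = F q powr (2 * s) * round_gram b q"
  using F volume_ratio_at_iff[of q "F q" s] norm_U[of q]
  unfolding metric_gram_def round_gram_def by (auto simp: image_subset_iff)

private lemma round_gram_nonneg: "q \<in> U \<Longrightarrow> round_gram b q \<ge> 0"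
  unfolding round_gram_def
  by (rule gram_det_nonneg[OF round.form dim_tangent_space]) (auto simp: norm_U)

private lemma frame_at:
  assumes p: "p \<in> U"
  obtains b :: "'n \<Rightarrow> 'n ambient" where "inj b"
    "orthonormal_basis (k p) (tangent_space p) (range b)"
    "(\<chi> i j. k p (tangent_proj p (b i)) (tangent_proj p (b j))) = mat 1" "metric_gram b p = 1" "round_gram b p > 0"
proof -
  interpret f: pos_def_form "tangent_space p" "k p" by (rule form[OF p])
  obtain b :: "'n \<Rightarrow> 'n ambient" where b: "inj b" "orthonormal_basis (k p) (tangent_space p) (range b)"
    using f.orthonormal_frame_exists[OF dim_tangent_space[OF norm_U[OF p]]] by blast
  have bt: "b i \<in> tangent_space p" for i using b by (auto simp: orthonormal_basis_def)
  have I: "(\<chi> i j. k p (tangent_proj p (b i)) (tangent_proj p (b j))) = mat 1"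
    using f.orthonormal_frame_gram[OF b] by (simp add: bt)
  then have M: "metric_gram b p = 1" by (simp add: metric_gram_def)
  then have "round_gram b p \<noteq> 0" using metric_gram_eq[OF p, of b] by auto
  then show thesis using that b I M round_gram_nonneg[OF p, of b] by force
qed

private lemma gram_smooth: "sphere_smooth_on U (metric_gram b)" "sphere_smooth_on U (round_gram b)"
  unfolding metric_gram_def[abs_def] round_gram_def[abs_def]
  by (rule sphere_smooth_on_det[OF open_U], rule component_smooth round.component_smooth)+

text \<open>Near \<open>p\<close> the function is a real power of the quotient of the two Gram determinants of a moved frame.\<close>

lemma volume_ratio_smooth: "sphere_smooth_on U F"
proof (rule sphere_smooth_on_local)
  fix p assume p: "p \<in> U"
  obtain b where b: "round_gram b p > 0" using frame_at[OF p] by blast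
  let ?W = "{q \<in> U. round_gram b q \<noteq> 0}"
  have "continuous_on UNIV (round_gram b)"
    unfolding round_gram_def det_def round_metric_def tangent_proj_def by (simp, intro continuous_intros)
  then have W: "sphere_open ?W" by (rule sphere_open_continuous_nonzero[OF open_U])
  have pos: "round_gram b q > 0" "metric_gram b q > 0" if "q \<in> ?W" for q
  proof -
    show "round_gram b q > 0" using that round_gram_nonneg[of q b] by auto
    then show "metric_gram b q > 0" using that F(1)[of q] by (auto simp: metric_gram_eq)
  qed
  have sM: "sphere_smooth_on ?W (metric_gram b)" and sN: "sphere_smooth_on ?W (round_gram b)"
    using gram_smooth[of b] by (auto intro: sphere_smooth_on_subset)
  have "sphere_smooth_on ?W (\<lambda>q. (metric_gram b q * inverse (round_gram b q)) powr (1 / (2 * s)))"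
    using pos by (intro sphere_smooth_on_powr[OF W] sphere_smooth_on_mult[OF W]
        sphere_smooth_on_inverse[OF W] sM sN) auto
  then have "sphere_smooth_on ?W F"
  proof (rule sphere_smooth_on_cong[OF W, rotated])
    fix q assume q: "q \<in> ?W"
    then have "metric_gram b q * inverse (round_gram b q) = F q powr (2 * s)"
      using pos[OF q] by (simp add: metric_gram_eq)
    then show "(metric_gram b q * inverse (round_gram b q)) powr (1 / (2 * s)) = F q"
      using s F(1)[of q] q by (simp add: powr_powr)
  qed
  moreover have "p \<in> ?W" using b p by simp
  ultimately show "\<exists>W. sphere_open W \<and> p \<in> W \<and> sphere_smooth_on W F"
    using W by (intro exI[of _ ?W] conjI)
qed

text \<open>Differentiate \<open>det k(b\<^sub>i, b\<^sub>j) = F\<^bsup>2s\<^esup> det (b\<^sub>i \<bullet> b\<^sub>j)\<close> for a moved frame that is \<open>k\<close>-orthonormal at \<open>p\<close>. The left-hand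
  side has the trace of \<open>cov_deriv k p x\<close> as derivative, and the round Gram determinant is
  stationary at \<open>p\<close>.\<close>

lemma volume_ratio_derivative:
  assumes p: "p \<in> U" and x: "x \<in> tangent_space p"
    and B: "orthonormal_basis (k p) (tangent_space p) B"
  shows "2 * s * sphere_deriv F p x = F p * (\<Sum>e\<in>B. cov_deriv k p x e e)"
proof -
  interpret f: pos_def_form "tangent_space p" "k p" by (rule form[OF p])
  obtain b where b: "inj b" "orthonormal_basis (k p) (tangent_space p) (range b)"
    "(\<chi> i j. k p (tangent_proj p (b i)) (tangent_proj p (b j))) = mat 1" "metric_gram b p = 1" "round_gram b p > 0"
    using frame_at[OF p] by blast
  have n: "norm p = 1" "p /\<^sub>R norm p = p" using norm_U[OF p] by auto
  have bt: "b i \<in> tangent_space p" for i using b(2) by (auto simp: orthonormal_basis_def)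
  have dM: "((\<lambda>y. metric_gram b (y /\<^sub>R norm y)) has_derivative (\<lambda>h. \<Sum>i\<in>UNIV. cov_deriv k p h (b i) (b i))) (at p)"
    unfolding metric_gram_def
    by (rule has_derivative_det_at_identity[OF component_derivative[OF p]]) (simp add: n b(3))
  define dN where "dN h = (\<Sum>\<sigma> | \<sigma> permutes (UNIV :: 'n set). of_int (sign \<sigma>) *
      (\<Sum>i\<in>UNIV. cov_deriv round_metric p h (b i) (b (\<sigma> i)) * (\<Prod>j\<in>UNIV - {i}.
        round_metric (p /\<^sub>R norm p) (tangent_proj (p /\<^sub>R norm p) (b j)) (tangent_proj (p /\<^sub>R norm p) (b (\<sigma> j))))))" for h
  have dN: "((\<lambda>y. round_gram b (y /\<^sub>R norm y)) has_derivative dN) (at p)"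
    unfolding round_gram_def dN_def by (rule has_derivative_det) (rule round.component_derivative[OF p])
  have dN0: "dN x = 0"
    unfolding dN_def by (simp add: cov_deriv_round[OF n(1) x bt bt])
  have dF: "((\<lambda>y. F (y /\<^sub>R norm y)) has_derivative sphere_deriv F p) (at p)"
    by (rule sphere_has_derivative[OF open_U p volume_ratio_smooth])
  have "((\<lambda>y. F (y /\<^sub>R norm y) powr (2 * s)) has_derivative
      (\<lambda>h. (F (p /\<^sub>R norm p) powr (2 * s)) *
        (0 * ln (F (p /\<^sub>R norm p)) + sphere_deriv F p h * (2 * s) / F (p /\<^sub>R norm p)))) (at p)"
    by (rule has_derivative_powr[OF dF has_derivative_const]) (use F(1) p n in auto)
  then have "((\<lambda>y. F (y /\<^sub>R norm y) powr (2 * s) * round_gram b (y /\<^sub>R norm y)) has_derivative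
      (\<lambda>h. F p powr (2 * s) * dN h + F p powr (2 * s) * (sphere_deriv F p h * (2 * s) / F p) * round_gram b p)) (at p)"
    using has_derivative_mult[OF _ dN] n by fastforce
  then have "((\<lambda>y. metric_gram b (y /\<^sub>R norm y)) has_derivative
      (\<lambda>h. F p powr (2 * s) * dN h + F p powr (2 * s) * (sphere_deriv F p h * (2 * s) / F p) * round_gram b p)) (at p)"
    by (rule has_derivative_radial_cong[OF open_U p, rotated]) (simp add: metric_gram_eq)
  from fun_cong[OF has_derivative_unique[OF dM this], of x]
  have "(\<Sum>i\<in>UNIV. cov_deriv k p x (b i) (b i)) =
      (F p powr (2 * s) * round_gram b p) * (sphere_deriv F p x * (2 * s) / F p)"
    by (simp add: dN0)
  also have "F p powr (2 * s) * round_gram b p = 1" using metric_gram_eq[OF p, of b] b(4) by simp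
  finally have "2 * s * sphere_deriv F p x = F p * (\<Sum>i\<in>UNIV. cov_deriv k p x (b i) (b i))"
    using F(1)[OF p] by (simp add: field_simps)
  also have "(\<Sum>i\<in>UNIV. cov_deriv k p x (b i) (b i)) = (\<Sum>e\<in>range b. cov_deriv k p x e e)"
    by (simp add: sum.reindex[OF b(1)])
  also have "\<dots> = (\<Sum>e\<in>B. cov_deriv k p x e e)"
    using linear_cov_deriv2[OF p] linear_cov_deriv3[OF p]
    by (intro f.trace_basis_independent[OF _ b(2) B]) (auto simp: bilinear_def)
  finally show ?thesis .
qed

end

end


section \<open>Killing tensors and metrics with minimal equators\<close>

lemma (in sphere_tensor) sphere_tensor_divide:
  assumes F: "\<And>p. p \<in> U \<Longrightarrow> F p > 0" "sphere_smooth_on U F"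
  shows "sphere_tensor U (\<lambda>p v w. 1 / F p * k p v w)"
proof
  have "sphere_smooth_on U (\<lambda>p. 1 / F p * k p (X p) (Y p))"
    if "vector_field_on U X" "vector_field_on U Y" for X Y
    using sphere_smooth_on_mult[OF open_U sphere_smooth_on_inverse[OF open_U F] tensor_smooth[OF that]]
    by (simp add: field_simps)
  then show "symmetric_tensor_on U (\<lambda>p v w. 1 / F p * k p v w)"
    using tensor by (auto simp: symmetric_tensor_on_def add_divide_distrib)
qed (rule open_U)

lemma (in sphere_metric) sphere_metric_divide:
  assumes "\<And>p. p \<in> U \<Longrightarrow> F p > 0" "sphere_smooth_on U F"
  shows "sphere_metric U (\<lambda>p v w. 1 / F p * k p v w)"
proof -
  interpret t: sphere_tensor U "\<lambda>p v w. 1 / F p * k p v w" by (rule sphere_tensor_divide[OF assms])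
  show ?thesis
    by unfold_locales (use pos_def assms(1) in \<open>auto simp: positive_definite_on_def\<close>)
qed

text \<open>The quotient rule, with the differential of \<open>F\<close> entering as \<open>dF / F\<close>.\<close>

lemma (in sphere_tensor) cov_deriv_divide:
  assumes F: "\<And>p. p \<in> U \<Longrightarrow> F p > 0" "sphere_smooth_on U F"
    and p: "p \<in> U" and yz: "y \<in> tangent_space p" "z \<in> tangent_space p"
  shows "cov_deriv (\<lambda>p v w. 1 / F p * k p v w) p x y z =
    1 / F p * (cov_deriv k p x y z - sphere_deriv F p x / F p * k p y z)"
proof -
  interpret t: sphere_tensor U "\<lambda>p v w. 1 / F p * k p v w" by (rule sphere_tensor_divide[OF F])
  have p': "p /\<^sub>R norm p = p" using norm_U[OF p] by simp
  have "((\<lambda>q. inverse (F (q /\<^sub>R norm q))) has_derivative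
      (\<lambda>h. - (inverse (F (p /\<^sub>R norm p)) * sphere_deriv F p h * inverse (F (p /\<^sub>R norm p))))) (at p)"
    by (rule Deriv.has_derivative_inverse[OF _ sphere_has_derivative[OF open_U p F(2)]]) (use F(1)[OF p] p' in auto)
  from t.cov_deriv_eqI[OF p has_derivative_mult[OF this component_derivative[OF p, of y z]], of y z x]
  have "cov_deriv (\<lambda>p v w. 1 / F p * k p v w) p x y z =
      inverse (F p) * cov_deriv k p x y z - inverse (F p) * sphere_deriv F p x * inverse (F p) * k p y z"
    unfolding p' using yz by (simp add: inverse_eq_divide)
  also have "\<dots> = 1 / F p * (cov_deriv k p x y z - sphere_deriv F p x / F p * k p y z)"
    by (simp add: inverse_eq_divide right_diff_distrib)
  finally show ?thesis .
qed

text \<open>Both properties say that the cubic form of \<open>g\<close> is a one-form times \<open>g\<close>: for Killing tensors the one-form is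
  \<open>\<phi> = dF / F\<close>, for minimal equators it is \<open>\<theta> = 2 div - tr\<close>. In each case the traced cubic
  identity \<open>tr + 2 div = (n + 2) \<eta>\<close> and the derivative \<open>(n + 1) \<phi> = 2 tr\<close> of the volume ratio show that the
  one-form is also the other one.\<close>

proposition killing_iff_equators_minimal:
  fixes U :: "'n::finite ambient set"
  assumes "sphere_metric U g"
    and F: "\<And>p. p \<in> U \<Longrightarrow> F p > 0"
      "\<And>p. p \<in> U \<Longrightarrow> volume_ratio_at g ((real CARD('n) + 1) / 4) p (F p)"
  shows "killing_tensor_on U round_metric (\<lambda>p v w. 1 / F p * g p v w) \<longleftrightarrow> equators_minimal U g"
proof -
  interpret sphere_metric U g by fact
  have s: "(real CARD('n) + 1) / 4 > 0" by simp
  have smooth: "sphere_smooth_on U F" by (rule volume_ratio_smooth[OF assms(1) s F])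
  interpret t: sphere_tensor U "\<lambda>p v w. 1 / F p * g p v w" by (rule sphere_tensor_divide[OF F(1) smooth])
  let ?\<phi> = "\<lambda>p x. sphere_deriv F p x / F p"
  let ?tr = "\<lambda>p B x. \<Sum>e\<in>B. cov_deriv g p x e e" and ?div = "\<lambda>p B x. \<Sum>e\<in>B. cov_deriv g p e e x"
  have volume: "(real CARD('n) + 1) * ?\<phi> p x = 2 * ?tr p B x"
    if "p \<in> U" "x \<in> tangent_space p" "orthonormal_basis (g p) (tangent_space p) B" for p x B
    using volume_ratio_derivative[OF assms(1) s F that] F(1)[OF that(1)] by (simp add: field_simps)
  have trace: "?tr p B x + 2 * ?div p B x = (real CARD('n) + 2) * \<theta> x"
    if p: "p \<in> U" and x: "x \<in> tangent_space p" and B: "orthonormal_basis (g p) (tangent_space p) B"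
      and \<theta>: "linear \<theta>" and cubic: "\<And>y. y \<in> tangent_space p \<Longrightarrow> cov_deriv g p y y y = \<theta> y * g p y y"
    for p x B \<theta>
  proof -
    interpret form: pos_def_form "tangent_space p" "g p" by (rule form[OF p])
    have "card B = CARD('n)"
      using form.card_orthonormal_basis[OF B] dim_tangent_space[OF norm_U[OF p]] by simp
    then show ?thesis
      using form.cubic_trace_identity[OF linear_cov_deriv1[OF p] linear_cov_deriv2[OF p]
          cov_deriv_sym[OF p] \<theta> cubic B x] by simp
  qed
  have "killing_tensor_on U round_metric (\<lambda>p v w. 1 / F p * g p v w) \<longleftrightarrow>
      (\<forall>p\<in>U. \<forall>x\<in>tangent_space p. cov_deriv g p x x x = ?\<phi> p x * g p x x)"
    unfolding t.killing_tensor_iff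
  proof (intro ball_cong refl)
    fix p x assume p: "p \<in> U" and x: "x \<in> tangent_space p"
    show "cov_deriv (\<lambda>p v w. 1 / F p * g p v w) p x x x = 0 \<longleftrightarrow> cov_deriv g p x x x = ?\<phi> p x * g p x x"
      by (subst cov_deriv_divide[OF F(1) smooth p x x]) (use F(1)[OF p] in simp_all)
  qed
  also have "\<dots> \<longleftrightarrow> equators_minimal U g"
    unfolding equators_minimal_iff
  proof (intro iffI ballI allI impI)
    fix p B x
    assume cubic: "\<forall>p\<in>U. \<forall>x\<in>tangent_space p. cov_deriv g p x x x = ?\<phi> p x * g p x x"
      and p: "p \<in> U" and B: "orthonormal_basis (g p) (tangent_space p) B" and x: "x \<in> tangent_space p"
    have "linear (?\<phi> p)"
      using linear_compose_scale_right[OF linear_sphere_deriv[OF open_U p smooth], of "1 / F p"] by simp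
    then have "?tr p B x + 2 * ?div p B x = (real CARD('n) + 2) * ?\<phi> p x"
      using trace[OF p x B] cubic p by blast
    with volume[OF p x B] have \<theta>: "?\<phi> p x = 2 * ?div p B x - ?tr p B x"
      unfolding distrib_right by linarith
    show "cov_deriv g p x x x = (2 * ?div p B x - ?tr p B x) * g p x x"
      unfolding \<theta>[symmetric] using cubic p x by blast
  next
    fix p x
    assume min: "\<forall>p\<in>U. \<forall>B. orthonormal_basis (g p) (tangent_space p) B \<longrightarrow> (\<forall>x\<in>tangent_space p.
        cov_deriv g p x x x = (2 * ?div p B x - ?tr p B x) * g p x x)"
      and p: "p \<in> U" and x: "x \<in> tangent_space p"
    interpret form: pos_def_form "tangent_space p" "g p" by (rule form[OF p])
    obtain B where B: "orthonormal_basis (g p) (tangent_space p) B"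
      using form.orthonormal_basis_exists by blast
    let ?\<theta> = "\<lambda>x. 2 * ?div p B x - ?tr p B x"
    note lin = linear_cov_deriv1[OF p] linear_cov_deriv3[OF p]
    have "linear ?\<theta>"
      by (rule linearI)
        (simp_all add: linear_add[OF lin(1)] linear_add[OF lin(2)] linear_cmul[OF lin(1)]
          linear_cmul[OF lin(2)] sum.distrib sum_distrib_left[symmetric] algebra_simps)
    then have "?tr p B x + 2 * ?div p B x = (real CARD('n) + 2) * ?\<theta> x"
      using trace[OF p x B] min p B by blast
    then have "(real CARD('n) + 1) * ?\<theta> x = 2 * ?tr p B x" by (simp add: algebra_simps)
    with volume[OF p x B] have "(real CARD('n) + 1) * ?\<theta> x = (real CARD('n) + 1) * ?\<phi> p x" by simp
    moreover have "real CARD('n) + 1 \<noteq> 0" by linarith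
    ultimately have "?\<theta> x = ?\<phi> p x" using mult_left_cancel by blast
    then show "cov_deriv g p x x x = ?\<phi> p x * g p x x"
      using min p B x by simp
  qed
  finally show ?thesis .
qed

lemma volume_element_scale:
  fixes h :: "'n::finite ambient tensor2"
  assumes "c > 0"
  shows "volume_element (\<lambda>p v w. c * h p v w) p e = c powr (real CARD('n) / 2) * volume_element h p e"
proof -
  have "det (\<chi> i j. c * h p (e i) (e j)) = c ^ CARD('n) * det (\<chi> i j. h p (e i) (e j))"
    using det_rows_mul[of "\<lambda>i. c" "\<lambda>i. \<chi> j. h p (e i) (e j)"]
    by (simp add: vector_scalar_mult_def)
  moreover have "sqrt (c ^ CARD('n)) = c powr (real CARD('n) / 2)"
    using assms by (simp add: powr_half_sqrt[symmetric] powr_realpow[symmetric] powr_powr)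
  ultimately show ?thesis by (simp add: volume_element_def real_sqrt_mult)
qed

text \<open>For \<open>s = (n+1)/4\<close> the new exponent is \<open>(n-1)/4\<close>, and vice versa.\<close>

lemma volume_ratio_at_divide:
  fixes h :: "'n::finite ambient tensor2"
  assumes "F p > 0" "volume_ratio_at h s p (F p)"
  shows "volume_ratio_at (\<lambda>p v w. 1 / F p * h p v w) (real CARD('n) / 2 - s) p (1 / F p)"
  unfolding volume_ratio_at_def
proof (intro allI impI)
  fix e :: "'n \<Rightarrow> 'n ambient" assume e: "range e \<subseteq> tangent_space p"
  have "volume_element (\<lambda>p v w. 1 / F p * h p v w) p e = volume_element (\<lambda>q v w. 1 / F p * h q v w) p e"
    by (simp add: volume_element_def)
  also have "\<dots> = (1 / F p) powr (real CARD('n) / 2) * (F p powr s * volume_element round_metric p e)"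
    using assms e by (subst volume_element_scale) (auto simp: volume_ratio_at_def)
  also have "\<dots> = (1 / F p) powr (real CARD('n) / 2 - s) * volume_element round_metric p e"
    using assms(1) by (simp add: powr_divide powr_diff)
  finally show "volume_element (\<lambda>p v w. 1 / F p * h p v w) p e =
      (1 / F p) powr (real CARD('n) / 2 - s) * volume_element round_metric p e" .
qed

theorem theorem2p6:
  fixes U :: "'n::finite ambient set"
  assumes "CARD('n) \<ge> 2"
    and "U \<noteq> {}"
    and "openin (top_of_set (sphere 0 1)) U"
  shows
    "(\<forall>g. riemannian_metric_on U g \<longrightarrow>
        sphere_smooth_on U (F_of g) \<and>
        (\<forall>p\<in>U. F_of g p > 0 \<and> volume_ratio_at g ((real CARD('n) + 1) / 4) p (F_of g p)) \<and>
        (equators_minimal U g \<longrightarrow>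
           positive_definite_on U (k_of g) \<and> killing_tensor_on U round_metric (k_of g)))
     \<and>
     (\<forall>k. positive_definite_on U k \<and> killing_tensor_on U round_metric k \<longrightarrow>
        sphere_smooth_on U (D_of k) \<and>
        (\<forall>p\<in>U. D_of k p > 0 \<and> volume_ratio_at k ((real CARD('n) - 1) / 4) p (D_of k p)) \<and>
        riemannian_metric_on U (g_of k) \<and> equators_minimal U (g_of k))
     \<and>
     (\<forall>g. riemannian_metric_on U g \<and> equators_minimal U g \<longrightarrow>
        tensor_eq_on U (g_of (k_of g)) g)
     \<and>
     (\<forall>k. positive_definite_on U k \<and> killing_tensor_on U round_metric k \<longrightarrow>
        tensor_eq_on U (k_of (g_of k)) k)"
proof -
  let ?s = "(real CARD('n) + 1) / 4" and ?r = "(real CARD('n) - 1) / 4"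
  \<comment> \<open>for \<open>n \<ge> 2\<close> the exponent in the definition of \<open>D_of\<close> is not zero, so the volume element determines the ratio\<close>
  have pos: "?s > 0" "?r > 0" using assms(1) by auto
  have dual: "real CARD('n) / 2 - ?s = ?r" "real CARD('n) / 2 - ?r = ?s" by (auto simp: field_simps)
  have open_U: "sphere_open U" using assms(3) by (simp add: sphere_open_def)
  have metric_iff: "riemannian_metric_on U h \<longleftrightarrow> sphere_metric U h" for h
    using open_U by (auto simp: riemannian_metric_on_def sphere_metric_def sphere_tensor_def
        sphere_metric_axioms_def)
  have metric_if_killing: "sphere_metric U k"
    if "positive_definite_on U k" "killing_tensor_on U round_metric k" for k
    using that unfolding metric_iff[symmetric] riemannian_metric_on_def killing_tensor_on_def by blast

  have F: "F_of g p > 0" "volume_ratio_at g ?s p (F_of g p)" if "sphere_metric U g" "p \<in> U" for g p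
    using the_volume_ratio[OF that pos(1)] unfolding F_of_def by auto
  have D: "D_of k p > 0" "volume_ratio_at k ?r p (D_of k p)" if "sphere_metric U k" "p \<in> U" for k p
    using the_volume_ratio[OF that pos(2)] unfolding D_of_def by auto
  have F_smooth: "sphere_smooth_on U (F_of g)" if "sphere_metric U g" for g
    by (rule volume_ratio_smooth[OF that pos(1) F[OF that]])
  have D_smooth: "sphere_smooth_on U (D_of k)" if "sphere_metric U k" for k
    by (rule volume_ratio_smooth[OF that pos(2) D[OF that]])
  have k_metric: "sphere_metric U (k_of g)" if "sphere_metric U g" for g
    using sphere_metric.sphere_metric_divide[OF that F(1)[OF that] F_smooth[OF that]]
    by (simp add: k_of_def[abs_def])
  have g_metric: "sphere_metric U (g_of k)" if "sphere_metric U k" for k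
    using sphere_metric.sphere_metric_divide[OF that D(1)[OF that] D_smooth[OF that]]
    by (simp add: g_of_def[abs_def])
  have D_k: "D_of (k_of g) p = 1 / F_of g p" if g: "sphere_metric U g" and p: "p \<in> U" for g p
  proof (rule volume_ratio_unique[OF k_metric[OF g] p pos(2) D[OF k_metric[OF g] p]])
    show "volume_ratio_at (k_of g) ?r p (1 / F_of g p)"
      using volume_ratio_at_divide[of "F_of g", OF F[OF g p]] by (simp only: k_of_def[abs_def] dual)
  qed (use F(1)[OF g p] in simp)
  have F_ratio: "volume_ratio_at (g_of k) ?s p (1 / D_of k p)" if k: "sphere_metric U k" and p: "p \<in> U" for k p
    using volume_ratio_at_divide[of "D_of k", OF D[OF k p]] by (simp only: g_of_def[abs_def] dual)
  have F_g: "F_of (g_of k) p = 1 / D_of k p" if k: "sphere_metric U k" and p: "p \<in> U" for k p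
    by (rule volume_ratio_unique[OF g_metric[OF k] p pos(1) F[OF g_metric[OF k] p] _ F_ratio[OF k p]])
      (use D(1)[OF k p] in simp)

  have inverse_g: "g_of (k_of g) p v w = g p v w" if "sphere_metric U g" "p \<in> U" for g p v w
    using D_k[OF that] F(1)[OF that] by (simp add: g_of_def k_of_def)
  have inverse_k: "k_of (g_of k) p v w = k p v w" if "sphere_metric U k" "p \<in> U" for k p v w
    using F_g[OF that] D(1)[OF that] by (simp add: g_of_def k_of_def)

  have killing: "killing_tensor_on U round_metric (k_of g) \<longleftrightarrow> equators_minimal U g"
    if "sphere_metric U g" for g
    using killing_iff_equators_minimal[OF that F[OF that]] by (simp add: k_of_def[abs_def])
  \<comment> \<open>a Killing tensor \<open>k\<close> coincides on \<open>U\<close> with \<open>k_of g\<close> for the metric \<open>g = g_of k\<close>\<close>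
  have minimal: "equators_minimal U (g_of k)"
    if k: "sphere_metric U k" and kill: "killing_tensor_on U round_metric k" for k
  proof -
    interpret k: sphere_tensor U k using k by (simp add: sphere_metric_def)
    interpret kg: sphere_tensor U "k_of (g_of k)"
      using k_metric[OF g_metric[OF k]] by (simp add: sphere_metric_def)
    have "cov_deriv (k_of (g_of k)) p x y z = cov_deriv k p x y z" if "p \<in> U" for p x y z
      by (rule kg.cov_deriv_eqI[OF that k.component_derivative[OF that]]) (simp add: inverse_k[OF k])
    then have "killing_tensor_on U round_metric (k_of (g_of k))"
      using kill by (simp add: k.killing_tensor_iff kg.killing_tensor_iff)
    then show ?thesis using killing[OF g_metric[OF k]] by blast
  qed
  have "positive_definite_on U (k_of g)" if "sphere_metric U g" for g
    using k_metric[OF that] unfolding metric_iff[symmetric] riemannian_metric_on_def by blast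
  then show ?thesis
    using F D F_smooth D_smooth killing minimal metric_if_killing g_metric inverse_g inverse_k
    unfolding metric_iff tensor_eq_on_def by simp
qed

end
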